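(* Let $\Bbbk$ be a field, let $t\ge 1$ and $n\ge 1$ be integers, and let $q\in\Bbbk^*$ be not a root of unity. Then every $\Bbbk$-algebra endomorphism of the $n$-fold tensor product $\mathscr{H}_q^t\otimes\cdots\otimes\mathscr{H}_q^t$ (over $\Bbbk$) is an automorphism.
   Context: For $q\in\Bbbk^*$ not a root of unity and an integer $t\ge1$, $\mathscr{H}_q^t$ is the $\Bbbk$-algebra generated by $\Omega,\Omega^{-1},\Psi,\Psi^{\dagger}$ subject to the relations $\Omega\Omega^{-1}=\Omega^{-1}\Omega=1$, $\Psi\Omega=q\Omega\Psi$, $\Psi^{\dagger}\Omega=q^{-1}\Omega\Psi^{\dagger}$, $\Psi\Psi^{\dagger}=\dfrac{q^t\Omega^t-q^{-t}\Omega^{-t}}{q^t-q^{-t}}$ and $\Psi^{\dagger}\Psi=\dfrac{\Omega^t-\Omega^{-t}}{q^t-q^{-t}}$. *)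

theory Defs
  imports Main "HOL-Algebra.QuotRing"
begin

text \<open>Elements are finitely supported functions from words (lists of generators) to k;
  multiplication is concatenation-convolution.  The carrier only contains polynomials
  whose words use generators from G.\<close>

definition fa_carrier :: "'g set \<Rightarrow> ('g list \<Rightarrow> 'k::field) set" where
  "fa_carrier G = {f. finite {w. f w \<noteq> 0} \<and> (\<forall>w. f w \<noteq> 0 \<longrightarrow> set w \<subseteq> G)}"

definition fmul :: "('g list \<Rightarrow> 'k::field) \<Rightarrow> ('g list \<Rightarrow> 'k) \<Rightarrow> ('g list \<Rightarrow> 'k)" where
  "fmul f g = (\<lambda>w. \<Sum>i\<le>length w. f (take i w) * g (drop i w))"

definition fadd :: "('g list \<Rightarrow> 'k::field) \<Rightarrow> ('g list \<Rightarrow> 'k) \<Rightarrow> ('g list \<Rightarrow> 'k)" where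
  "fadd f g = (\<lambda>w. f w + g w)"

definition fsub :: "('g list \<Rightarrow> 'k::field) \<Rightarrow> ('g list \<Rightarrow> 'k) \<Rightarrow> ('g list \<Rightarrow> 'k)" where
  "fsub f g = (\<lambda>w. f w - g w)"

definition fsmul :: "'k::field \<Rightarrow> ('g list \<Rightarrow> 'k) \<Rightarrow> ('g list \<Rightarrow> 'k)" where
  "fsmul c f = (\<lambda>w. c * f w)"

definition fconst :: "'k::field \<Rightarrow> ('g list \<Rightarrow> 'k)" where
  "fconst c = (\<lambda>w. if w = [] then c else 0)"

definition fgen :: "'g \<Rightarrow> ('g list \<Rightarrow> 'k::field)" where
  "fgen x = (\<lambda>w. if w = [x] then 1 else 0)"

definition fpow :: "('g list \<Rightarrow> 'k::field) \<Rightarrow> nat \<Rightarrow> ('g list \<Rightarrow> 'k)" where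
  "fpow f k = ((fmul f) ^^ k) (fconst 1)"

definition free_alg :: "'g set \<Rightarrow> ('g list \<Rightarrow> 'k::field) ring" where
  "free_alg G = \<lparr>carrier = fa_carrier G, mult = fmul, one = fconst 1,
                 zero = (\<lambda>w. 0), add = fadd\<rparr>"

datatype hgen = Om | Omi | Psi | Psid

text \<open>Defining relations (as elements r with r = 0) of one copy of H_q^t whose generators are
  named via e.  Here c = 1/(q^t - q^{-t}).\<close>

definition H_rels :: "'k::field \<Rightarrow> nat \<Rightarrow> (hgen \<Rightarrow> 'g) \<Rightarrow> ('g list \<Rightarrow> 'k) set" where
  "H_rels q t e =
    (let W1 = fgen (e Om); W2 = fgen (e Omi); Y1 = fgen (e Psi); Y2 = fgen (e Psid);
         c = inverse (q ^ t - inverse q ^ t) in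
     { fsub (fmul W1 W2) (fconst 1),
       fsub (fmul W2 W1) (fconst 1),
       fsub (fmul Y1 W1) (fsmul q (fmul W1 Y1)),
       fsub (fmul Y2 W1) (fsmul (inverse q) (fmul W1 Y2)),
       fsub (fmul Y1 Y2) (fsmul c (fsub (fsmul (q ^ t) (fpow W1 t)) (fsmul (inverse q ^ t) (fpow W2 t)))),
       fsub (fmul Y2 Y1) (fsmul c (fsub (fpow W1 t) (fpow W2 t))) })"

definition tgens :: "nat \<Rightarrow> (nat \<times> hgen) set" where
  "tgens n = {(i, g). i < n}"

definition tensor_rels :: "'k::field \<Rightarrow> nat \<Rightarrow> nat \<Rightarrow> ((nat \<times> hgen) list \<Rightarrow> 'k) set" where
  "tensor_rels q t n =
     (\<Union>i<n. H_rels q t (\<lambda>g. (i, g))) \<union>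
     {fsub (fmul (fgen (i, a)) (fgen (j, b))) (fmul (fgen (j, b)) (fgen (i, a))) | i j a b.
        i < n \<and> j < n \<and> i \<noteq> j}"

definition tensor_ideal :: "'k::field \<Rightarrow> nat \<Rightarrow> nat \<Rightarrow> ((nat \<times> hgen) list \<Rightarrow> 'k) set" where
  "tensor_ideal q t n = genideal (free_alg (tgens n)) (tensor_rels q t n)"

definition tensorH :: "'k::field \<Rightarrow> nat \<Rightarrow> nat \<Rightarrow> ((nat \<times> hgen) list \<Rightarrow> 'k) set ring" where
  "tensorH q t n = free_alg (tgens n) Quot tensor_ideal q t n"

definition tensorH_scalar :: "'k::field \<Rightarrow> nat \<Rightarrow> nat \<Rightarrow> 'k \<Rightarrow> ((nat \<times> hgen) list \<Rightarrow> 'k) set" where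
  "tensorH_scalar q t n c = tensor_ideal q t n +>\<^bsub>free_alg (tgens n)\<^esub> fconst c"

text \<open>k-algebra endomorphism: unital ring endomorphism fixing the scalars
  (equivalently, a k-linear unital ring endomorphism).\<close>

definition is_alg_endo :: "'k::field \<Rightarrow> nat \<Rightarrow> nat \<Rightarrow>
    (((nat \<times> hgen) list \<Rightarrow> 'k) set \<Rightarrow> ((nat \<times> hgen) list \<Rightarrow> 'k) set) \<Rightarrow> bool" where
  "is_alg_endo q t n f \<longleftrightarrow>
     f \<in> ring_hom (tensorH q t n) (tensorH q t n) \<and>
     (\<forall>c. f (tensorH_scalar q t n c) = tensorH_scalar q t n c)"

end

theory Submission
  imports Defs "HOL-Library.Poly_Mapping" "HOL-Library.Product_Lexorder" "HOL-Library.Product_Plus"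
begin

text \<open>
  The tensor product \<open>H\<close> is embedded into the quantum torus with generators
  \<open>\<Omega>\<^sub>i, x\<^sub>i\<close> and relations \<open>x\<^sub>i \<Omega>\<^sub>i = q \<Omega>\<^sub>i x\<^sub>i\<close> by \<open>\<Psi>\<^sub>i \<mapsto> x\<^sub>i\<close> and \<open>\<Psi>\<^sub>i\<dagger> \<mapsto> a\<^sub>i x\<^sub>i\<inverse>\<close>, where
  \<open>a\<^sub>i = (\<Omega>\<^sub>i^t - \<Omega>\<^sub>i^(-t)) / (q^t - q^(-t))\<close>.  The torus is a domain graded by \<open>\<int>^(2n)\<close>, and an element of
  \<open>H\<close> all of whose terms have negative degree in \<open>x\<^sub>j\<close> is a multiple of \<open>a\<^sub>j\<close>.

  Units of the torus are monomials, and the divisibility by \<open>a\<^sub>j\<close> forces units of \<open>H\<close> to be scalar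
  multiples of monomials in the \<open>\<Omega>\<^sub>j\<close>.  So an endomorphism \<open>f\<close> sends \<open>\<Omega>\<^sub>i\<close> to \<open>c\<^sub>i \<Omega>^\<alpha>\<^sub>i\<close>.  As \<open>f \<Psi>\<^sub>i\<dagger> f \<Psi>\<^sub>i = f a\<^sub>i\<close>
  is homogeneous of degree \<open>0\<close> in every \<open>x\<^sub>j\<close>, both factors are homogeneous, say of degrees
  \<open>- d\<^sub>i\<close> and \<open>d\<^sub>i\<close>, and \<open>q\<close>-commutation gives \<open>\<langle>d\<^sub>i, \<alpha>\<^sub>j\<rangle> = \<delta>\<^sub>i\<^sub>j\<close>.  Whenever the \<open>j\<close>-th entry of \<open>d\<^sub>i\<close> is nonzero, \<open>a\<^sub>j\<close> divides
  the binomial \<open>f a\<^sub>i\<close> or its shift, so the two exponents of that binomial lie on the \<open>j\<close>-th axis.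
  Hence \<open>\<alpha>\<^sub>i = d\<^sub>i = \<plusminus> e\<^sub>j\<close>, and \<open>f\<close> permutes the tensor factors up to swapping \<open>\<Psi>\<close> with \<open>\<Psi>\<dagger>\<close>
  and up to monomial units.  Surjectivity is then immediate, and injectivity holds since the
  leading exponents of the images of the normal monomials are distinct.
\<close>

section \<open>Twisted Laurent polynomials\<close>

abbreviation "lookup \<equiv> Poly_Mapping.lookup"
abbreviation "keys \<equiv> Poly_Mapping.keys"
abbreviation "single \<equiv> Poly_Mapping.single"

type_synonym expo = "nat \<Rightarrow>\<^sub>0 int"
text \<open>The pair \<open>(\<beta>, d)\<close> is the exponent of the monomial \<open>\<Omega>^\<beta> x^d\<close>.\<close>

type_synonym 'k torus = "(expo \<times> expo) \<Rightarrow>\<^sub>0 'k"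

text \<open>The lexicographic order makes \<open>expo \<times> expo\<close> a linearly ordered
  abelian group, so every nonzero torus element has a leading exponent.\<close>

instance prod :: (linordered_ab_group_add, linordered_ab_group_add) linordered_ab_group_add
proof
  fix a b c :: "'a \<times> 'b"
  assume "a \<le> b" then show "c + a \<le> c + b"
    by (cases a; cases b; cases c) (auto simp: less_eq_prod_def)
qed

lemma add_eq_add_le_imp_eq:
  fixes u v :: "'a::linordered_ab_group_add"
  assumes "u \<le> u'" "v \<le> v'" "u + v = u' + v'"
  shows "u = u' \<and> v = v'"
  using assms add_less_le_mono[of u u' v v'] add_le_less_mono[of u u' v v'] by force

lemma poly_mapping_sum_singles:
  fixes f :: "'a \<Rightarrow>\<^sub>0 'b::comm_monoid_add"
  shows "f = (\<Sum>u\<in>keys f. single u (lookup f u))"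
  by (rule poly_mapping_eqI) (auto simp: lookup_sum lookup_single when_def in_keys_iff sum.delta')

lemma single_eq_0_iff [simp]: "single u c = 0 \<longleftrightarrow> c = 0"
  by (metis lookup_single_eq lookup_zero single_zero)

lemma single_eq_single_iff [simp]: "single u c = single u d \<longleftrightarrow> c = d"
  by (metis lookup_single_eq)

lemma poly_mapping_single_induct [case_names zero single add]:
  fixes f :: "'a \<Rightarrow>\<^sub>0 'b::comm_monoid_add"
  assumes "P 0" and "\<And>u c. P (single u c)" and "\<And>f g. P f \<Longrightarrow> P g \<Longrightarrow> P (f + g)"
  shows "P f"
proof -
  have "P (\<Sum>u\<in>A. single u (lookup f u))" if "finite A" for A
    using that by (induction A rule: finite_induct) (auto intro: assms)
  then show ?thesis
    by (metis poly_mapping_sum_singles finite_keys)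
qed

lemma poly_mapping_split:
  fixes f :: "'a \<Rightarrow>\<^sub>0 'b::comm_monoid_add"
  obtains g h where "f = g + h" "keys g \<subseteq> S" "keys h \<inter> S = {}"
proof -
  have "\<exists>g h. f = g + h \<and> keys g \<subseteq> S \<and> keys h \<inter> S = {}"
  proof (induction f rule: poly_mapping_single_induct)
    case zero
    show ?case by (intro exI[of _ 0]) auto
  next
    case (single u c)
    show ?case
    proof (cases "u \<in> S")
      case True
      then show ?thesis by (intro exI[of _ "single u c"] exI[of _ 0]) (auto split: if_splits)
    next
      case False
      then show ?thesis by (intro exI[of _ "single u c"] exI[of _ 0]) (auto split: if_splits)
    qed
  next
    case (add f1 f2)
    then obtain g1 h1 g2 h2 where *: "f1 = g1 + h1" "keys g1 \<subseteq> S" "keys h1 \<inter> S = {}"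
      "f2 = g2 + h2" "keys g2 \<subseteq> S" "keys h2 \<inter> S = {}" by blast
    show ?case
      using * keys_add[of g1 g2] keys_add[of h1 h2]
      by (intro exI[of _ "g1 + g2"] exI[of _ "h1 + h2"]) (auto simp: ac_simps)
  qed
  then show thesis using that by blast
qed

section \<open>Pairing of exponents and the twisted multiplication\<close>

definition dot :: "expo \<Rightarrow> expo \<Rightarrow> int" where
  "dot d b = (\<Sum>i\<in>keys d. lookup d i * lookup b i)"

lemma dot_superset: "finite A \<Longrightarrow> keys d \<subseteq> A \<Longrightarrow> dot d b = (\<Sum>i\<in>A. lookup d i * lookup b i)"
  unfolding dot_def by (rule sum.mono_neutral_left) (auto simp: in_keys_iff)

lemma dot_add_right: "dot d (b + c) = dot d b + dot d c"
  by (simp add: dot_def lookup_add distrib_left sum.distrib)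

lemma dot_add_left: "dot (b + c) d = dot b d + dot c d"
proof -
  have "keys (b + c) \<subseteq> keys b \<union> keys c" by (rule keys_add)
  then show ?thesis
    by (simp add: dot_superset[of "keys b \<union> keys c"] lookup_add distrib_right sum.distrib)
qed

lemma dot_zero [simp]: "dot 0 d = 0" "dot d 0 = 0"
  by (simp_all add: dot_def)

lemma dot_single_left [simp]: "dot (single i c) b = c * lookup b i"
  by (simp add: dot_superset[of "{i}"])

lemma dot_single_right [simp]: "dot d (single i c) = lookup d i * c"
  by (subst dot_superset[of "insert i (keys d)"]) (auto simp: lookup_single when_def if_distrib cong: if_cong)

text \<open>Monomials are kept with the \<Omega> on the left; moving \<open>x^d\<close> to the right
  past \<open>\<Omega>^\<beta>\<close> costs q to the power \<open>dot d \<beta>\<close>, which is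
  the twist factor.\<close>

definition tmul :: "'k::field \<Rightarrow> 'k torus \<Rightarrow> 'k torus \<Rightarrow> 'k torus" where
  "tmul q P Q = (\<Sum>u\<in>keys P. \<Sum>v\<in>keys Q.
     single (u + v) (lookup P u * lookup Q v * q powi dot (snd u) (fst v)))"

lemma tmul_superset:
  assumes "finite A" "keys P \<subseteq> A" "finite B" "keys Q \<subseteq> B"
  shows "tmul q P Q = (\<Sum>u\<in>A. \<Sum>v\<in>B.
     single (u + v) (lookup P u * lookup Q v * q powi dot (snd u) (fst v)))"
proof -
  have "tmul q P Q = (\<Sum>u\<in>keys P. \<Sum>v\<in>B.
     single (u + v) (lookup P u * lookup Q v * q powi dot (snd u) (fst v)))"
    unfolding tmul_def
    by (intro sum.cong refl sum.mono_neutral_left) (use assms in \<open>auto simp: in_keys_iff\<close>)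
  also have "\<dots> = (\<Sum>u\<in>A. \<Sum>v\<in>B.
     single (u + v) (lookup P u * lookup Q v * q powi dot (snd u) (fst v)))"
    by (intro sum.mono_neutral_left) (use assms in \<open>auto simp: in_keys_iff\<close>)
  finally show ?thesis .
qed

section \<open>Ring structure, leading terms and gradings of the quantum torus\<close>

locale quantum_torus =
  fixes q :: "'k::field"
  assumes q_nz: "q \<noteq> 0"
    and q_generic: "\<And>m::nat. m > 0 \<Longrightarrow> q ^ m \<noteq> 1"
begin

abbreviation mul :: "'k torus \<Rightarrow> 'k torus \<Rightarrow> 'k torus" (infixl \<open>\<star>\<close> 70) where
  "P \<star> Q \<equiv> tmul q P Q"

lemma powi_eq_1D:
  assumes "q powi m = 1" shows "m = 0"
proof (rule ccontr)
  assume "m \<noteq> 0"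
  have "q ^ nat \<bar>m\<bar> = 1"
    using assms by (auto simp: power_int_def abs_if power_inverse split: if_splits)
  moreover have "nat \<bar>m\<bar> > 0" using \<open>m \<noteq> 0\<close> by simp
  ultimately show False using q_generic by blast
qed

lemma powi_inj:
  assumes "q powi a = q powi b" shows "a = b"
proof -
  have "q powi (a - b) = 1" using assms q_nz by (simp add: power_int_diff)
  then show ?thesis using powi_eq_1D by fastforce
qed

lemma powi_nz [simp]: "q powi m \<noteq> 0"
  using q_nz by simp

lemma mul_add_left: "(P + P') \<star> Q = P \<star> Q + P' \<star> Q"
  using keys_add[of P P']
  by (simp add: tmul_superset[of "keys P \<union> keys P'" _ "keys Q"] lookup_add distrib_right
      single_add sum.distrib)

lemma mul_add_right: "P \<star> (Q + Q') = P \<star> Q + P \<star> Q'"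
  using keys_add[of Q Q']
  by (simp add: tmul_superset[of "keys P" _ "keys Q \<union> keys Q'"] lookup_add distrib_right
      distrib_left single_add sum.distrib)

lemma mul_zero [simp]: "0 \<star> Q = 0" "P \<star> 0 = 0"
  by (simp_all add: tmul_def)

lemma mul_minus_left: "(- P) \<star> Q = - (P \<star> Q)"
  using mul_add_left[of P "-P" Q] by (simp add: eq_neg_iff_add_eq_0 add.commute)

lemma mul_minus_right: "P \<star> (- Q) = - (P \<star> Q)"
  using mul_add_right[of P Q "-Q"] by (simp add: eq_neg_iff_add_eq_0 add.commute)

lemma mul_diff_left: "(P - P') \<star> Q = P \<star> Q - P' \<star> Q"
  using mul_add_left[of P "- P'" Q] by (simp add: mul_minus_left)

lemma mul_diff_right: "P \<star> (Q - Q') = P \<star> Q - P \<star> Q'"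
  using mul_add_right[of P Q "- Q'"] by (simp add: mul_minus_right)

lemma mul_single:
  "single u c \<star> single v d
   = single (u + v) (c * d * q powi dot (snd u) (fst v))"
  by (simp add: tmul_superset[of "{u}" _ "{v}"])

lemma mul_assoc: "P \<star> Q \<star> R = P \<star> (Q \<star> R)"
proof (induction P rule: poly_mapping_single_induct)
  case (single u c)
  show ?case
  proof (induction Q rule: poly_mapping_single_induct)
    case (single v d)
    show ?case
    proof (induction R rule: poly_mapping_single_induct)
      case (single w e)
      show ?case
        by (simp add: mul_single power_int_add q_nz dot_add_left dot_add_right mult_ac add.assoc)
    qed (simp_all add: mul_add_left mul_add_right)
  qed (simp_all add: mul_add_left mul_add_right)
qed (simp_all add: mul_add_left mul_add_right)

lemma mul_one [simp]: "1 \<star> P = P" "P \<star> 1 = P"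
proof -
  have "single 0 1 \<star> P = P" "P \<star> single 0 1 = P"
    by (induction P rule: poly_mapping_single_induct;
        simp add: mul_single mul_add_left mul_add_right del: single_one)+
  then show "1 \<star> P = P" "P \<star> 1 = P" by simp_all
qed

lemma scalar_central: "single 0 c \<star> P = P \<star> single 0 c"
  by (induction P rule: poly_mapping_single_induct)
    (simp_all add: mul_single mul_add_left mul_add_right mult_ac)

lemma lookup_single_mul:
  "lookup (single u c \<star> P) (u + w) = c * lookup P w * q powi dot (snd u) (fst w)"
  by (induction P rule: poly_mapping_single_induct)
    (auto simp: mul_single mul_add_right lookup_add lookup_single when_def algebra_simps)

lemma lookup_mul_single:
  "lookup (P \<star> single u c) (w + u) = c * lookup P w * q powi dot (snd w) (fst u)"
  by (induction P rule: poly_mapping_single_induct)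
    (auto simp: mul_single mul_add_left lookup_add lookup_single when_def algebra_simps)

lemma lookup_scalar [simp]: "lookup (single 0 c \<star> P) w = c * lookup P w"
  using lookup_single_mul[of 0 c P w] by simp

lemma keys_mul:
  assumes "s \<in> keys (P \<star> Q)"
  obtains u v where "u \<in> keys P" "v \<in> keys Q" "s = u + v"
proof -
  have "keys (P \<star> Q) \<subseteq> (\<Union>u\<in>keys P. \<Union>v\<in>keys Q. {u + v})"
    unfolding tmul_def
    by (intro order_trans[OF keys_sum] UN_mono subset_refl) (auto split: if_splits)
  then show thesis using assms that by blast
qed

text \<open>By \<open>mono\<close>, the sum of two \<open>h\<close>-maximal exponents arises from
  only one pair of terms, so its coefficient is a single nonzero product and nothing cancels. The
  general \<open>h\<close> covers both the order of exponents and its refinements by a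
  degree.\<close>

lemma mul_extremal:
  fixes h :: "expo \<times> expo \<Rightarrow> 'o::linorder"
  assumes "P \<noteq> 0" "Q \<noteq> 0"
    and mono: "\<And>u u' v v'. h u \<le> h u' \<Longrightarrow> h v \<le> h v' \<Longrightarrow> u + v = u' + v' \<Longrightarrow> u = u' \<and> v = v'"
  obtains u v where "u \<in> keys P" "v \<in> keys Q" "u + v \<in> keys (P \<star> Q)"
    "\<And>x. x \<in> keys P \<Longrightarrow> h x \<le> h u" "\<And>y. y \<in> keys Q \<Longrightarrow> h y \<le> h v"
proof -
  have ex: "\<exists>u\<in>keys P. \<forall>x\<in>keys P. h x \<le> h u" if "P \<noteq> 0" for P :: "'k torus"
  proof -
    have "Max (h ` keys P) \<in> h ` keys P" using that by (intro Max_in) auto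
    then obtain u where "u \<in> keys P" "h u = Max (h ` keys P)" by auto
    then show ?thesis by (intro bexI[of _ u]) auto
  qed
  obtain u v where u: "u \<in> keys P" "\<And>x. x \<in> keys P \<Longrightarrow> h x \<le> h u"
    and v: "v \<in> keys Q" "\<And>y. y \<in> keys Q \<Longrightarrow> h y \<le> h v"
    using ex assms(1,2) by meson
  have uniq: "x + y = u + v \<longleftrightarrow> x = u \<and> y = v" if "x \<in> keys P" "y \<in> keys Q" for x y
    using mono[of x u y v] u v that by blast
  have "lookup (P \<star> Q) (u + v) = (\<Sum>x\<in>keys P. \<Sum>y\<in>keys Q.
      if x = u \<and> y = v then lookup P x * lookup Q y * q powi dot (snd x) (fst y) else 0)"
    unfolding tmul_def lookup_sum
    by (intro sum.cong refl) (auto simp: lookup_single when_def uniq)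
  also have "\<dots> = (\<Sum>x\<in>keys P. if x = u then
      (\<Sum>y\<in>keys Q. if y = v then lookup P x * lookup Q y * q powi dot (snd x) (fst y) else 0) else 0)"
    by (intro sum.cong refl) auto
  also have "\<dots> = lookup P u * lookup Q v * q powi dot (snd u) (fst v)"
    using u v by (simp add: sum.delta)
  also have "\<dots> \<noteq> 0" using u(1) v(1) q_nz by (simp add: in_keys_iff)
  finally have "u + v \<in> keys (P \<star> Q)" by (metis in_keys_iff)
  then show thesis using that u v by blast
qed

text \<open>The case of \<open>h\<close> the identity: leading exponents add, and the torus is a
  domain.\<close>

lemma mul_max_key:
  assumes "P \<noteq> 0" "Q \<noteq> 0"
  shows "P \<star> Q \<noteq> 0" "Max (keys (P \<star> Q)) = Max (keys P) + Max (keys Q)"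
proof -
  obtain u v where uv: "u \<in> keys P" "v \<in> keys Q" "u + v \<in> keys (P \<star> Q)"
    "\<And>x. x \<in> keys P \<Longrightarrow> x \<le> u" "\<And>y. y \<in> keys Q \<Longrightarrow> y \<le> v"
    using mul_extremal[OF assms, of "\<lambda>x. x"] add_eq_add_le_imp_eq by blast
  show "P \<star> Q \<noteq> 0" using uv(3) by auto
  have "Max (keys P) = u" "Max (keys Q) = v" using uv by (auto intro!: Max_eqI)
  moreover have "Max (keys (P \<star> Q)) = u + v"
  proof (intro Max_eqI)
    fix s assume "s \<in> keys (P \<star> Q)"
    then obtain x y where "x \<in> keys P" "y \<in> keys Q" "s = x + y" by (rule keys_mul)
    then show "s \<le> u + v" using uv(4,5) by (simp only: add_mono)
  qed (use uv in auto)
  ultimately show "Max (keys (P \<star> Q)) = Max (keys P) + Max (keys Q)" by simp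
qed

text \<open>Many terms may share the top degree. Comparing by \<open>l\<close> first and by the
  exponent second breaks the ties and is still compatible with addition.\<close>

lemma mul_max_degree:
  fixes l :: "expo \<times> expo \<Rightarrow> int"
  assumes "P \<noteq> 0" "Q \<noteq> 0" and add: "\<And>u v. l (u + v) = l u + l v"
  obtains u v where "u \<in> keys P" "v \<in> keys Q" "u + v \<in> keys (P \<star> Q)"
    "\<And>x. x \<in> keys P \<Longrightarrow> l x \<le> l u" "\<And>y. y \<in> keys Q \<Longrightarrow> l y \<le> l v"
proof (rule mul_extremal[OF assms(1,2), of "\<lambda>x. (l x, x)"])
  fix u u' v v' :: "expo \<times> expo"
  assume *: "(l u, u) \<le> (l u', u')" "(l v, v) \<le> (l v', v')" "u + v = u' + v'"
  then have "l u + l v = l u' + l v'" by (metis add)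
  with * have "u \<le> u'" "v \<le> v'" by (auto simp: less_eq_prod_def)
  with *(3) show "u = u' \<and> v = v'"
    by (intro add_eq_add_le_imp_eq)
next
  fix u v assume "u \<in> keys P" "v \<in> keys Q" "u + v \<in> keys (P \<star> Q)"
    "\<And>x. x \<in> keys P \<Longrightarrow> (l x, x) \<le> (l u, u)" "\<And>y. y \<in> keys Q \<Longrightarrow> (l y, y) \<le> (l v, v)"
  then show thesis by (intro that[of u v]) (auto simp: less_eq_prod_def order.order_iff_strict)
qed

text \<open>By \<open>mul_max_degree\<close> for \<open>l\<close> and for \<open>- l\<close>, the
  top degrees of the factors add up to \<open>c\<close>, and so do the bottom degrees; hence top and
  bottom agree in each factor.\<close>

lemma mul_homogeneous:
  fixes l :: "expo \<times> expo \<Rightarrow> int"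
  assumes nz: "P \<noteq> 0" "Q \<noteq> 0" and add: "\<And>u v. l (u + v) = l u + l v"
    and hom: "\<And>s. s \<in> keys (P \<star> Q) \<Longrightarrow> l s = c"
  shows "\<exists>a. (\<forall>u\<in>keys P. l u = a) \<and> (\<forall>v\<in>keys Q. l v = c - a)"
proof -
  obtain u v where uv: "u \<in> keys P" "v \<in> keys Q" "u + v \<in> keys (P \<star> Q)"
    "\<And>x. x \<in> keys P \<Longrightarrow> l x \<le> l u" "\<And>y. y \<in> keys Q \<Longrightarrow> l y \<le> l v"
    using mul_max_degree[OF nz add] by blast
  obtain u' v' where uv': "u' \<in> keys P" "v' \<in> keys Q" "u' + v' \<in> keys (P \<star> Q)"
    "\<And>x. x \<in> keys P \<Longrightarrow> - l x \<le> - l u'" "\<And>y. y \<in> keys Q \<Longrightarrow> - l y \<le> - l v'"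
    by (rule mul_max_degree[OF nz, of "\<lambda>x. - l x"]) (simp_all add: add)
  have c: "l u + l v = c" "l u' + l v' = c" using hom uv(3) uv'(3) add by metis+
  have eq: "l u = l u'" "l v = l v'"
    using uv(4)[OF uv'(1)] uv(5)[OF uv'(2)] c by linarith+
  show ?thesis
  proof (intro exI[of _ "l u"] conjI ballI)
    fix x assume "x \<in> keys P" then show "l x = l u" using uv(4) uv'(4) eq by fastforce
  next
    fix x assume "x \<in> keys Q" then show "l x = c - l u" using uv(5) uv'(5) eq c by fastforce
  qed
qed

end

section \<open>Free algebras\<close>

definition fmon :: "'g list \<Rightarrow> 'k::field \<Rightarrow> 'g list \<Rightarrow> 'k" where
  "fmon w c = (\<lambda>v. if v = w then c else 0)"

lemma fgen_eq_fmon: "fgen x = fmon [x] 1"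
  by (simp add: fgen_def fmon_def)

lemma fconst_eq_fmon: "fconst c = fmon [] c"
  by (simp add: fconst_def fmon_def)

lemma fmon_carrier [simp]: "set w \<subseteq> G \<Longrightarrow> fmon w c \<in> fa_carrier G"
  by (auto simp: fa_carrier_def fmon_def)

lemma fconst_carrier [simp]: "fconst c \<in> fa_carrier G"
  by (simp add: fconst_eq_fmon)

lemma fgen_carrier [simp]: "x \<in> G \<Longrightarrow> fgen x \<in> fa_carrier G"
  by (simp add: fgen_eq_fmon)

lemma zero_carrier [simp]: "(\<lambda>w. 0) \<in> fa_carrier G"
  by (simp add: fa_carrier_def)

lemma fadd_carrier [simp]:
  assumes "f \<in> fa_carrier G" "g \<in> fa_carrier G" shows "fadd f g \<in> fa_carrier G"
proof -
  have "{w. fadd f g w \<noteq> 0} \<subseteq> {w. f w \<noteq> 0} \<union> {w. g w \<noteq> 0}" by (auto simp: fadd_def)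
  then show ?thesis
    using assms unfolding fa_carrier_def
    by (auto intro: finite_subset)
qed

lemma fsmul_carrier [simp]: "f \<in> fa_carrier G \<Longrightarrow> fsmul c f \<in> fa_carrier G"
  by (auto simp: fa_carrier_def fsmul_def elim: rev_finite_subset)

lemma fsub_eq: "fsub f g = fadd f (fsmul (- 1) g)"
  by (simp add: fsub_def fadd_def fsmul_def)

lemma fsub_carrier [simp]: "f \<in> fa_carrier G \<Longrightarrow> g \<in> fa_carrier G \<Longrightarrow> fsub f g \<in> fa_carrier G"
  by (simp add: fsub_eq)

lemma fmul_carrier [simp]:
  assumes "f \<in> fa_carrier G" "g \<in> fa_carrier G" shows "fmul f g \<in> fa_carrier G"
proof -
  have ex: "\<exists>u v. w = u @ v \<and> f u \<noteq> 0 \<and> g v \<noteq> 0" if "fmul f g w \<noteq> 0" for w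
  proof -
    obtain i where "f (take i w) * g (drop i w) \<noteq> 0"
      using \<open>fmul f g w \<noteq> 0\<close> unfolding fmul_def by (meson sum.neutral)
    then show ?thesis by (intro exI[of _ "take i w"] exI[of _ "drop i w"]) auto
  qed
  have "{w. fmul f g w \<noteq> 0} \<subseteq> (\<lambda>(u, v). u @ v) ` ({w. f w \<noteq> 0} \<times> {w. g w \<noteq> 0})"
    using ex by fast
  moreover have "finite ({w. f w \<noteq> 0} \<times> {w. g w \<noteq> 0})"
    using assms by (simp add: fa_carrier_def)
  ultimately have "finite {w. fmul f g w \<noteq> 0}" by (meson finite_imageI finite_subset)
  moreover have "set w \<subseteq> G" if "fmul f g w \<noteq> 0" for w
    using ex[OF that] assms by (force simp: fa_carrier_def)
  ultimately show ?thesis by (simp add: fa_carrier_def)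
qed

lemma fpow_Suc: "fpow f (Suc k) = fmul f (fpow f k)"
  by (simp add: fpow_def)

lemma fpow_0: "fpow f 0 = fconst 1"
  by (simp add: fpow_def)

lemma fpow_carrier [simp]: "f \<in> fa_carrier G \<Longrightarrow> fpow f k \<in> fa_carrier G"
  by (induction k) (simp_all add: fpow_Suc fpow_0)

lemma fmul_fmon: "fmul (fmon u c) (fmon v d) = fmon (u @ v) (c * d)"
proof
  fix z
  show "fmul (fmon u c) (fmon v d) z = fmon (u @ v) (c * d) z"
  proof (cases "z = u @ v")
    case True
    have iff: "take i z = u \<and> drop i z = v \<longleftrightarrow> i = length u" if "i \<le> length z" for i
    proof
      assume "take i z = u \<and> drop i z = v"
      then have "length (take i z) = length u" by simp
      then show "i = length u" using that by simp
    qed (simp add: True)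
    have "fmul (fmon u c) (fmon v d) z = (\<Sum>i\<le>length z. if i = length u then c * d else 0)"
      unfolding fmul_def
    proof (intro sum.cong refl)
      fix i assume "i \<in> {..length z}"
      then show "fmon u c (take i z) * fmon v d (drop i z) = (if i = length u then c * d else 0)"
        using iff[of i] by (simp only: fmon_def atMost_iff) (metis mult_zero_left mult_zero_right)
    qed
    then show ?thesis using True by (simp add: fmon_def)
  next
    case False
    have "fmul (fmon u c) (fmon v d) z = 0"
      unfolding fmul_def using False by (intro sum.neutral) (auto simp: fmon_def)
    then show ?thesis using False by (simp add: fmon_def)
  qed
qed

lemma fsmul_eq: "fsmul c f = fmul (fconst c) f"
proof
  fix w
  have "fmul (fconst c) f w = (\<Sum>i\<le>length w. if i = 0 then c * f w else 0)"
    unfolding fmul_def by (intro sum.cong refl) (auto simp: fconst_def)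
  then show "fsmul c f w = fmul (fconst c) f w" by (simp add: fsmul_def)
qed

lemma fmul_fconst_right: "fmul f (fconst c) = fsmul c f"
proof
  fix w
  have "fmul f (fconst c) w = (\<Sum>i\<le>length w. if i = length w then c * f w else 0)"
    unfolding fmul_def by (intro sum.cong refl) (auto simp: fconst_def)
  then show "fmul f (fconst c) w = fsmul c f w" by (simp add: fsmul_def)
qed

lemma fmul_assoc: "fmul (fmul f g) h = fmul f (fmul g h)"
proof
  fix w :: "'a list"
  let ?n = "length w"
  have "fmul (fmul f g) h w
      = (\<Sum>i\<le>?n. \<Sum>j\<le>i. f (take j w) * g (drop j (take i w)) * h (drop i w))"
    unfolding fmul_def by (intro sum.cong refl) (simp add: sum_distrib_right min_def)
  \<comment> \<open>Either bracketing sums over two cut points \<open>j \<le> i\<close>; they are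
    re-indexed by \<open>j\<close> and the length \<open>k = i - j\<close> of the middle
    piece.\<close>
  also have "\<dots> = (\<Sum>j\<le>?n. \<Sum>k\<le>?n - j. f (take j w) * g (take k (drop j w)) * h (drop (k + j) w))"
    by (simp add: sum.Sigma)
      (rule sum.reindex_bij_witness[of _ "\<lambda>(j, k). (k + j, j)" "\<lambda>(i, j). (j, i - j)"],
        auto simp: drop_take)
  also have "\<dots> = fmul f (fmul g h) w"
    unfolding fmul_def by (intro sum.cong refl) (simp add: sum_distrib_left mult.assoc)
  finally show "fmul (fmul f g) h w = fmul f (fmul g h) w" .
qed

lemma fmul_fadd_left: "fmul (fadd f g) h = fadd (fmul f h) (fmul g h)"
  by (simp add: fmul_def fadd_def distrib_right sum.distrib)

lemma fmul_fadd_right: "fmul h (fadd f g) = fadd (fmul h f) (fmul h g)"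
  by (simp add: fmul_def fadd_def distrib_left sum.distrib)

lemma fmul_one [simp]: "fmul (fconst 1) f = f" "fmul f (fconst 1) = f"
  by (simp_all add: fmul_fconst_right) (simp_all add: fsmul_eq[symmetric] fsmul_def)

lemma free_alg_simps [simp]:
  "carrier (free_alg G) = fa_carrier G" "mult (free_alg G) = fmul" "add (free_alg G) = fadd"
  "one (free_alg G) = fconst 1" "zero (free_alg G) = (\<lambda>w. 0)"
  by (simp_all add: free_alg_def)

lemma fadd_assoc: "fadd (fadd f g) h = fadd f (fadd g h)"
  by (simp add: fadd_def add.assoc)

lemma fadd_commute: "fadd f g = fadd g f"
  by (simp add: fadd_def add.commute)

lemma fsmul_minus_one: "fadd (fsmul (- 1) f) f = (\<lambda>w. 0)"
  by (simp add: fadd_def fsmul_def)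

lemma fadd_zero: "fadd (\<lambda>w. 0) f = f"
  by (simp add: fadd_def)

lemma ring_free_alg: "ring (free_alg G :: ('g list \<Rightarrow> 'k::field) ring)" (is "ring ?R")
proof (rule ringI)
  show "abelian_group ?R"
  proof (rule abelian_groupI)
    fix f assume "f \<in> carrier ?R"
    then show "\<exists>g\<in>carrier ?R. g \<oplus>\<^bsub>?R\<^esub> f = \<zero>\<^bsub>?R\<^esub>"
      by (intro bexI[of _ "fsmul (- 1) f"]) (simp_all add: fsmul_minus_one)
  qed (auto simp: fadd_assoc fadd_zero intro: fadd_commute)
  show "Group.monoid ?R"
    by (rule monoidI) (simp_all add: fmul_assoc)
qed (simp_all add: fmul_fadd_left fmul_fadd_right)

lemma fa_mon_induct [consumes 1, case_names mon add]:
  assumes "f \<in> fa_carrier G"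
    and mon: "\<And>w c. set w \<subseteq> G \<Longrightarrow> P (fmon w c)"
    and add: "\<And>f g. f \<in> fa_carrier G \<Longrightarrow> P f \<Longrightarrow> g \<in> fa_carrier G \<Longrightarrow> P g \<Longrightarrow> P (fadd f g)"
  shows "P f"
proof -
  have "P f" if "finite A" "{w. f w \<noteq> 0} = A" "f \<in> fa_carrier G" for A f
    using that
  proof (induction A arbitrary: f rule: finite_induct)
    case empty
    then have "f = fmon [] 0" by (auto simp: fmon_def)
    then show ?case using mon[of "[]" 0] by simp
  next
    case (insert w A)
    let ?g = "f(w := 0)"
    have "{v. ?g v \<noteq> 0} = A" using insert by auto
    moreover have g: "?g \<in> fa_carrier G"
      using insert.prems(2) by (auto simp: fa_carrier_def elim: rev_finite_subset)
    ultimately have "P ?g" using insert.IH by blast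
    moreover have w: "set w \<subseteq> G" using insert.prems by (auto simp: fa_carrier_def)
    moreover have "f = fadd (fmon w (f w)) ?g" by (auto simp: fadd_def fmon_def)
    ultimately show ?case using add[of "fmon w (f w)" ?g] mon g by simp
  qed
  then show ?thesis using assms(1) by (auto simp: fa_carrier_def)
qed

text \<open>Both sides are needed: the span of normal monomials is built by left multiplication with
  generators, while divisibility by \<open>av j\<close> is propagated through right
  multiplication.\<close>

lemma fa_induct_left [consumes 1, case_names const gen add]:
  assumes "f \<in> fa_carrier G"
    and const: "\<And>c. P (fconst c)"
    and gen: "\<And>f x. f \<in> fa_carrier G \<Longrightarrow> P f \<Longrightarrow> x \<in> G \<Longrightarrow> P (fmul (fgen x) f)"
    and add: "\<And>f g. f \<in> fa_carrier G \<Longrightarrow> P f \<Longrightarrow> g \<in> fa_carrier G \<Longrightarrow> P g \<Longrightarrow> P (fadd f g)"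
  shows "P f"
  using assms(1)
proof (induction rule: fa_mon_induct)
  case (mon w c)
  then show ?case
  proof (induction w)
    case (Cons x w)
    then show ?case using gen[of "fmon w c" x] by (simp add: fgen_eq_fmon fmul_fmon)
  qed (simp add: const flip: fconst_eq_fmon)
qed (rule add)

lemma fa_induct_right [consumes 1, case_names const gen add]:
  assumes "f \<in> fa_carrier G"
    and const: "\<And>c. P (fconst c)"
    and gen: "\<And>f x. f \<in> fa_carrier G \<Longrightarrow> P f \<Longrightarrow> x \<in> G \<Longrightarrow> P (fmul f (fgen x))"
    and add: "\<And>f g. f \<in> fa_carrier G \<Longrightarrow> P f \<Longrightarrow> g \<in> fa_carrier G \<Longrightarrow> P g \<Longrightarrow> P (fadd f g)"
  shows "P f"
  using assms(1)
proof (induction rule: fa_mon_induct)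
  case (mon w c)
  then show ?case
  proof (induction w rule: rev_induct)
    case (snoc x w)
    then show ?case using gen[of "fmon w c" x] by (simp add: fgen_eq_fmon fmul_fmon)
  qed (simp add: const flip: fconst_eq_fmon)
qed (rule add)

section \<open>Homomorphisms to the quantum torus\<close>

definition torus_ring :: "'k::field \<Rightarrow> 'k torus ring" where
  "torus_ring q = \<lparr>carrier = UNIV, mult = tmul q, one = 1, zero = 0, add = (+)\<rparr>"

lemma torus_ring_simps [simp]:
  "carrier (torus_ring q) = UNIV" "mult (torus_ring q) = tmul q" "add (torus_ring q) = (+)"
  "one (torus_ring q) = 1" "zero (torus_ring q) = 0"
  by (simp_all add: torus_ring_def)

context quantum_torus
begin

lemma ring_torus_ring: "ring (torus_ring q)"
proof (rule ringI)
  show "abelian_group (torus_ring q)"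
  proof (rule abelian_groupI)
    fix x show "\<exists>y\<in>carrier (torus_ring q). y \<oplus>\<^bsub>torus_ring q\<^esub> x = \<zero>\<^bsub>torus_ring q\<^esub>"
      by (intro bexI[of _ "- x"]) simp_all
  qed (simp_all add: ac_simps)
next
  show "Group.monoid (torus_ring q)"
    by (rule monoidI) (simp_all add: mul_assoc)
qed (simp_all add: mul_add_left mul_add_right)

primrec wprod :: "('g \<Rightarrow> 'k torus) \<Rightarrow> 'g list \<Rightarrow> 'k torus" where
  "wprod \<theta> [] = 1"
| "wprod \<theta> (x # w) = \<theta> x \<star> wprod \<theta> w"

lemma wprod_append: "wprod \<theta> (u @ v) = wprod \<theta> u \<star> wprod \<theta> v"
  by (induction u) (simp_all add: mul_assoc)

text \<open>Evaluation at \<theta>: the homomorphism given by the universal property of the free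
  algebra.\<close>

definition ev :: "('g \<Rightarrow> 'k torus) \<Rightarrow> ('g list \<Rightarrow> 'k) \<Rightarrow> 'k torus" where
  "ev \<theta> f = (\<Sum>w | f w \<noteq> 0. single 0 (f w) \<star> wprod \<theta> w)"

lemma ev_fmon [simp]: "ev \<theta> (fmon w c) = single 0 c \<star> wprod \<theta> w"
proof (cases "c = 0")
  case False
  then have "{v. fmon w c v \<noteq> 0} = {w}" by (auto simp: fmon_def)
  then show ?thesis by (simp add: ev_def fmon_def)
qed (simp add: ev_def fmon_def)

lemma ev_fadd:
  assumes "f \<in> fa_carrier G" "g \<in> fa_carrier G"
  shows "ev \<theta> (fadd f g) = ev \<theta> f + ev \<theta> g"
proof -
  let ?A = "{w. f w \<noteq> 0} \<union> {w. g w \<noteq> 0}"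
  have fin: "finite ?A" using assms by (simp add: fa_carrier_def)
  have *: "ev \<theta> h = (\<Sum>w\<in>?A. single 0 (h w) \<star> wprod \<theta> w)" if "{w. h w \<noteq> 0} \<subseteq> ?A" for h
    unfolding ev_def using that fin by (intro sum.mono_neutral_left) auto
  have "{w. fadd f g w \<noteq> 0} \<subseteq> ?A" by (auto simp: fadd_def)
  then have "ev \<theta> (fadd f g) = (\<Sum>w\<in>?A. single 0 (fadd f g w) \<star> wprod \<theta> w)" by (rule *)
  also have "\<dots> = ev \<theta> f + ev \<theta> g"
    by (subst (1 2) *) (auto simp: fadd_def single_add mul_add_left sum.distrib)
  finally show ?thesis .
qed

lemma ev_fmul:
  assumes "f \<in> fa_carrier G" "g \<in> fa_carrier G"
  shows "ev \<theta> (fmul f g) = ev \<theta> f \<star> ev \<theta> g"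
  using assms(1)
proof (induction rule: fa_mon_induct)
  case (mon u c)
  show ?case
    using assms(2)
  proof (induction rule: fa_mon_induct)
    case (mon v d)
    have "single 0 (c * d) \<star> (wprod \<theta> u \<star> wprod \<theta> v) = single 0 c \<star> (single 0 d \<star> wprod \<theta> u) \<star> wprod \<theta> v"
      by (simp add: mul_single flip: mul_assoc)
    then show ?case
      by (simp add: fmul_fmon wprod_append mul_assoc scalar_central[of d "wprod \<theta> u"])
  next
    case (add f1 f2)
    then show ?case using mon by (simp add: fmul_fadd_right ev_fadd[of _ G] mul_add_right)
  qed
next
  case (add f1 f2)
  then show ?case using assms(2) by (simp add: fmul_fadd_left ev_fadd[of _ G] mul_add_left)
qed

lemma ev_hom: "ev \<theta> \<in> ring_hom (free_alg G) (torus_ring q)"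
proof (rule ring_hom_memI)
  show "ev \<theta> \<one>\<^bsub>free_alg G\<^esub> = \<one>\<^bsub>torus_ring q\<^esub>"
    by (simp add: fconst_eq_fmon)
qed (simp_all add: ev_fadd[of _ G] ev_fmul[of _ G])

lemma ev_fconst [simp]: "ev \<theta> (fconst c) = single 0 c"
  using mul_single[of 0 c 0 1] by (simp add: fconst_eq_fmon)

lemma ev_fgen [simp]: "ev \<theta> (fgen x) = \<theta> x"
  by (simp add: fgen_eq_fmon)

lemma ev_fsmul: "f \<in> fa_carrier G \<Longrightarrow> ev \<theta> (fsmul c f) = single 0 c \<star> ev \<theta> f"
  by (simp add: fsmul_eq ev_fmul[of _ G])

lemma ev_fsub:
  assumes "f \<in> fa_carrier G" "g \<in> fa_carrier G"
  shows "ev \<theta> (fsub f g) = ev \<theta> f - ev \<theta> g"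
proof -
  have "f = fadd (fsub f g) g" by (simp add: fsub_def fadd_def)
  then have "ev \<theta> f = ev \<theta> (fsub f g) + ev \<theta> g"
    using assms ev_fadd[of "fsub f g" G g] by simp
  then show ?thesis by simp
qed

end

section \<open>The tensor product inside the quantum torus\<close>

context quantum_torus
begin

lemma pow_single:
  "(mul (single (\<alpha>, 0) c) ^^ k) 1 = single (frag_cmul (int k) \<alpha>, 0) (c ^ k)"
proof (induction k)
  case 0
  show ?case by (simp add: zero_prod_def[symmetric])
next
  case (Suc k)
  then show ?case
    by (simp add: mul_single frag_cmul_distrib)
qed

lemma mul_single_q_commute:
  assumes "\<And>v. v \<in> keys P \<Longrightarrow> dot (snd v) (fst u) = m + dot (snd u) (fst v)"
  shows "P \<star> single u c = single 0 (q powi m) \<star> (single u c \<star> P)"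
proof (rule poly_mapping_eqI)
  fix k
  have k: "k = (k - u) + u" "k = u + (k - u)" by simp_all
  have "lookup (P \<star> single u c) ((k - u) + u) = q powi m * lookup (single u c \<star> P) (u + (k - u))"
    unfolding lookup_single_mul lookup_mul_single
    using assms[of "k - u"] by (cases "k - u \<in> keys P") (auto simp: power_int_add q_nz in_keys_iff)
  then show "lookup (P \<star> single u c) k = lookup (single 0 (q powi m) \<star> (single u c \<star> P)) k"
    by simp
qed

text \<open>At the exponent \<open>v + u\<close> each side receives only the term \<open>v\<close>
  of \<open>P\<close>. This leaves an equation between powers of q, whose exponents agree because q
  is not a root of unity.\<close>

lemma q_commuteD:
  assumes "P \<star> single u c = single 0 (q powi m) \<star> (single u c \<star> P)" "c \<noteq> 0" "v \<in> keys P"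
  shows "dot (snd v) (fst u) = m + dot (snd u) (fst v)"
proof -
  have "c * lookup P v * q powi dot (snd v) (fst u)
      = q powi m * (c * lookup P v * q powi dot (snd u) (fst v))"
    using arg_cong[OF assms(1), of "\<lambda>R. lookup R (v + u)"]
    by (simp add: lookup_mul_single) (simp add: add.commute[of v u] lookup_single_mul)
  moreover have "lookup P v \<noteq> 0" using assms(3) by (simp add: in_keys_iff)
  ultimately have "q powi dot (snd v) (fst u) = q powi (m + dot (snd u) (fst v))"
    using assms(2) by (simp add: power_int_add q_nz)
  then show ?thesis by (rule powi_inj)
qed

lemma single_if_coordinates_constant:
  fixes P :: "'k torus"
  assumes "P \<noteq> 0"
    and "\<And>i. \<exists>a. \<forall>u\<in>keys P. lookup (fst u) i = a"
    and "\<And>i. \<exists>a. \<forall>u\<in>keys P. lookup (snd u) i = a"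
  obtains u c where "c \<noteq> 0" "P = single u c"
proof -
  obtain u where u: "u \<in> keys P" using assms(1) by (metis all_not_in_conv keys_eq_empty)
  have "v = u" if "v \<in> keys P" for v
  proof (intro prod_eqI poly_mapping_eqI)
    show "lookup (fst v) i = lookup (fst u) i" for i using assms(2)[of i] u that by auto
    show "lookup (snd v) i = lookup (snd u) i" for i using assms(3)[of i] u that by auto
  qed
  then have "keys P = {u}" using u by blast
  have "P = (\<Sum>v\<in>keys P. single v (lookup P v))" by (rule poly_mapping_sum_singles)
  also have "\<dots> = single u (lookup P u)" unfolding \<open>keys P = {u}\<close> by simp
  finally have "P = single u (lookup P u)" .
  moreover have "lookup P u \<noteq> 0" using u by (simp add: in_keys_iff)
  ultimately show thesis using that by blast
qed

text \<open>Every coordinate of the exponent is a degree, and a monomial is homogeneous for all of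
  them, so \<open>mul_homogeneous\<close> makes both factors homogeneous in every
  coordinate.\<close>

lemma mul_eq_single:
  assumes "P \<star> Q = single s c" "c \<noteq> 0"
  obtains u a v b where "a \<noteq> 0" "b \<noteq> 0" "P = single u a" "Q = single v b"
proof -
  have nz: "P \<noteq> 0" "Q \<noteq> 0" using assms by (metis mul_zero single_eq_0_iff)+
  have hom: "\<exists>a b. (\<forall>u\<in>keys P. l u = a) \<and> (\<forall>u\<in>keys Q. l u = b)"
    if "\<And>u v. l (u + v) = l u + l v" for l :: "expo \<times> expo \<Rightarrow> int"
  proof -
    have "l r = l s" if "r \<in> keys (P \<star> Q)" for r
      using that by (simp add: assms split: if_splits)
    then show ?thesis using mul_homogeneous[OF nz that, of "l s"] by blast
  qed
  have "\<exists>a b. (\<forall>u\<in>keys P. lookup (fst u) i = a) \<and> (\<forall>u\<in>keys Q. lookup (fst u) i = b)" for i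
    by (rule hom) (simp add: lookup_add)
  moreover have "\<exists>a b. (\<forall>u\<in>keys P. lookup (snd u) i = a) \<and> (\<forall>u\<in>keys Q. lookup (snd u) i = b)" for i
    by (rule hom) (simp add: lookup_add)
  ultimately show thesis
    using that single_if_coordinates_constant[OF nz(1)] single_if_coordinates_constant[OF nz(2)]
    by metis
qed

end

section \<open>The image of the tensor product in the torus and divisibility by
  \<open>av j\<close>\<close>

locale gwa_torus = quantum_torus q for q :: "'k::field" +
  fixes t n :: nat
  assumes t_pos: "t \<ge> 1"
begin

abbreviation "kappa \<equiv> inverse (q ^ t - inverse q ^ t)"

lemma kappa_nz: "kappa \<noteq> 0"
proof
  assume "kappa = 0"
  then have "q ^ t * q ^ t = inverse q ^ t * q ^ t" by simp
  then have "q ^ (t + t) = 1" using q_nz by (simp add: power_add power_inverse)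
  then show False using q_generic[of "t + t"] t_pos by simp
qed

definition av :: "nat \<Rightarrow> 'k torus" where
  "av j = single (single j (int t), 0) kappa - single (single j (- int t), 0) kappa"

definition gv :: "nat \<times> hgen \<Rightarrow> 'k torus" where
  "gv p = (case p of (i, g) \<Rightarrow> (case g of
      Om \<Rightarrow> single (single i 1, 0) 1
    | Omi \<Rightarrow> single (single i (- 1), 0) 1
    | Psi \<Rightarrow> single (0, single i 1) 1
    | Psid \<Rightarrow> av i \<star> single (0, single i (- 1)) 1))"

lemma single_neq_uminus: "single j (int t) \<noteq> single j (- int t)"
  using t_pos by simp

lemma lookup_av: "lookup (av j) u =
    (if u = (single j (int t), 0) then kappa else if u = (single j (- int t), 0) then - kappa else 0)"
  using t_pos by (auto simp: av_def lookup_minus lookup_single when_def)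

lemma keys_av: "keys (av j) = {(single j (int t), 0), (single j (- int t), 0)}"
  using kappa_nz t_pos by (auto simp: in_keys_iff lookup_av split: if_splits)

lemma gv_Psid: "gv (i, Psid) = single (single i (int t), single i (- 1)) kappa
    - single (single i (- int t), single i (- 1)) kappa"
  by (simp add: gv_def av_def mul_diff_left mul_single)

lemmas gv_simps = gv_Psid gv_def[of "(_, Om)", simplified] gv_def[of "(_, Omi)", simplified]
  gv_def[of "(_, Psi)", simplified]

lemma frag_cmul_single [simp]: "frag_cmul m (single i k) = single i (m * k)"
  by (rule poly_mapping_eqI) (simp add: lookup_single when_def)

lemma ev_fpow:
  assumes "f \<in> fa_carrier G"
  shows "ev \<theta> (fpow f k) = (mul (ev \<theta> f) ^^ k) 1"
  using assms by (induction k) (simp_all add: fpow_0 fpow_Suc ev_fmul[of _ G])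

lemma gv_commute:
  assumes "i \<noteq> j" shows "gv (i, a) \<star> gv (j, b) = gv (j, b) \<star> gv (i, a)"
  using assms
  by (cases a; cases b)
    (simp_all add: gv_simps mul_diff_left mul_diff_right mul_single lookup_single add.commute)

text \<open>In the product of \<open>Psid\<close> and \<open>Psi\<close> the powers of
  \<open>x\<^sub>i\<close> cancel and leave \<open>av i\<close>. In the other order
  \<open>av i\<close> is conjugated by \<open>x\<^sub>i\<close>, which multiplies its two terms by
  \<open>q^t\<close> and \<open>q^(-t)\<close>, as the relation demands.\<close>

lemma ev_gv_relations:
  assumes "r \<in> tensor_rels q t n"
  shows "ev gv r = 0"
proof -
  have zero: "(0, 0) = (0 :: expo \<times> expo)" by (simp add: zero_prod_def)
  have cancel: "single x (1 :: int) + single x (- 1) = 0" for x :: nat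
    by (simp flip: single_add)
  note simps = ev_fsub[of _ UNIV] ev_fmul[of _ UNIV] ev_fsmul[of _ UNIV] ev_fpow[of _ UNIV]
    mul_single mul_diff_left mul_diff_right gv_simps pow_single zero cancel
    single_diff[symmetric] power_int_minus power_inverse
  show ?thesis
    using assms unfolding tensor_rels_def H_rels_def Let_def
    by (auto simp: simps gv_commute add.commute mult_ac)
qed

lemma tensor_rels_subset: "tensor_rels q t n \<subseteq> fa_carrier (tgens n)"
  unfolding tensor_rels_def H_rels_def Let_def
  by (auto simp: tgens_def)

text \<open>The copy of the tensor product in the torus. The divisibility arguments take place here;
  the identification with the tensor product comes with \<open>tensor_rep_inj\<close>.\<close>

definition img :: "'k torus set" where
  "img = ev gv ` fa_carrier (tgens n)"

text \<open>Torus exponents may have any index, so membership in \<open>img\<close> is what confines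
  them to the \<open>n\<close> tensor factors. This later gives \<open>j < n\<close> and controls
  the monomial units in the surjectivity argument.\<close>

lemma img_support:
  assumes "R \<in> img" "u \<in> keys R" "i \<ge> n"
  shows "lookup (fst u) i = 0 \<and> lookup (snd u) i = 0"
proof -
  have "\<forall>u\<in>keys (ev gv f). lookup (fst u) i = 0 \<and> lookup (snd u) i = 0"
    if "f \<in> fa_carrier (tgens n)" for f
    using that
  proof (induction rule: fa_induct_right)
    case (const c)
    show ?case by simp
  next
    case (gen f x)
    have "\<forall>u\<in>keys (gv x). lookup (fst u) i = 0 \<and> lookup (snd u) i = 0"
    proof -
      obtain j g where x: "x = (j, g)" by (cases x)
      then have "j < n" using \<open>x \<in> tgens n\<close> by (simp add: tgens_def)
      then show ?thesis
        using \<open>i \<ge> n\<close> x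
        by (cases g) (auto simp: gv_simps lookup_single when_def in_keys_iff lookup_minus split: if_splits)
    qed
    moreover have "\<forall>u\<in>keys (ev gv f). lookup (fst u) i = 0 \<and> lookup (snd u) i = 0"
      by (rule gen)
    moreover have "ev gv (fmul f (fgen x)) = ev gv f \<star> gv x"
      using gen by (simp_all add: ev_fmul[of _ "tgens n"])
    moreover have "lookup (fst (u + v)) i = 0 \<and> lookup (snd (u + v)) i = 0"
      if "u \<in> keys (ev gv f)" "v \<in> keys (gv x)" for u v
      using that calculation by (simp add: lookup_add)
    ultimately show ?case by (metis keys_mul)
  next
    case (add f g)
    then show ?case using keys_add[of "ev gv f" "ev gv g"] by (auto simp: ev_fadd[of _ "tgens n"])
  qed
  then show ?thesis using assms by (auto simp: img_def)
qed

lemma av_commute: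
  assumes "\<And>u. u \<in> keys P \<Longrightarrow> lookup (snd u) j = 0"
  shows "P \<star> av j = av j \<star> P"
proof -
  have "P \<star> single (single j k, 0) c = single (single j k, 0) c \<star> P" for k c
    using mul_single_q_commute[of P "(single j k, 0)" 0 c] assms by simp
  then show ?thesis by (simp add: av_def mul_diff_left mul_diff_right)
qed

text \<open>
  Divisibility by \<open>av j\<close> of the part of negative \<open>j\<close>-degree is preserved by right multiplication with a
  generator, but not by left multiplication: \<open>x\<^sub>j\<close> turns \<open>a\<^sub>j\<close> into a shift of \<open>a\<^sub>j\<close>.
\<close>

lemma img_decompose:
  assumes "R \<in> img"
  obtains p w where "R = p + av j \<star> w" "\<And>u. u \<in> keys p \<Longrightarrow> lookup (snd u) j \<ge> 0"
proof -
  let ?D = "\<lambda>R. \<exists>p w. R = p + av j \<star> w \<and> (\<forall>u\<in>keys p. lookup (snd u) j \<ge> 0)"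
  have D_add: "?D (R + S)" if DR: "?D R" and DS: "?D S" for R S
  proof -
    obtain p w p' w' where "R = p + av j \<star> w" "\<forall>u\<in>keys p. lookup (snd u) j \<ge> 0"
      "S = p' + av j \<star> w'" "\<forall>u\<in>keys p'. lookup (snd u) j \<ge> 0"
      using DR DS by blast
    then show ?thesis
      using keys_add[of p p']
      by (intro exI[of _ "p + p'"] exI[of _ "w + w'"]) (auto simp: mul_add_right)
  qed
  have D_nonneg: "?D p" if "\<forall>u\<in>keys p. lookup (snd u) j \<ge> 0" for p
    using that by (intro exI[of _ p] exI[of _ 0]) simp
  have D_av: "?D (av j \<star> w)" for w
    by (intro exI[of _ 0] exI[of _ w]) simp
  have D_gen: "?D (p \<star> gv x)" if p: "\<forall>u\<in>keys p. lookup (snd u) j \<ge> 0" for p x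
  proof (cases "x = (j, Psid)")
    case True
    \<comment> \<open>Only \<open>Psid\<close> of index \<open>j\<close> lowers the
      \<open>j\<close>-degree, and it does so by one. Hence only the part \<open>p0\<close> of
      degree zero becomes negative, and \<open>p0\<close> commutes with \<open>av j\<close>.\<close>
    obtain p0 p1 where p01: "p = p0 + p1" "keys p0 \<subseteq> {u. lookup (snd u) j = 0}"
      "keys p1 \<inter> {u. lookup (snd u) j = 0} = {}"
      by (rule poly_mapping_split)
    have p1: "lookup (snd u) j > 0" if "u \<in> keys p1" for u
    proof -
      have "u \<notin> keys p0" using p01 that by auto
      then have "u \<in> keys p" using that p01(1) by (simp add: in_keys_iff lookup_add)
      then show ?thesis using p p01(3) that by fastforce
    qed
    have "p0 \<star> gv x = av j \<star> (p0 \<star> single (0, single j (- 1)) 1)"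
    proof -
      have "p0 \<star> av j = av j \<star> p0" using p01(2) by (intro av_commute) blast
      then show ?thesis by (simp add: True gv_def flip: mul_assoc)
    qed
    moreover have "\<forall>u\<in>keys (p1 \<star> gv x). lookup (snd u) j \<ge> 0"
      using p1 by (auto elim!: keys_mul simp: True gv_Psid in_keys_iff lookup_minus lookup_single
          lookup_add when_def split: if_splits)
    ultimately show ?thesis
      using D_add[OF D_av D_nonneg] by (simp add: p01(1) mul_add_left)
  next
    case False
    obtain i g where x: "x = (i, g)" by (cases x)
    have gv: "\<forall>u\<in>keys (gv x). lookup (snd u) j \<ge> 0"
      using False x
      by (cases g) (auto simp: gv_simps lookup_single when_def in_keys_iff lookup_minus split: if_splits)
    show ?thesis
    proof (intro D_nonneg ballI)
      fix s assume "s \<in> keys (p \<star> gv x)"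
      then obtain u v where "u \<in> keys p" "v \<in> keys (gv x)" "s = u + v" by (rule keys_mul)
      then show "lookup (snd s) j \<ge> 0" using p gv by (simp add: lookup_add)
    qed
  qed
  have "?D (ev gv f)" if "f \<in> fa_carrier (tgens n)" for f
    using that
  proof (induction rule: fa_induct_right)
    case (const c)
    show ?case by (intro D_nonneg) (simp add: zero_prod_def)
  next
    case (gen f x)
    then obtain p w where pw: "ev gv f = p + av j \<star> w" "\<forall>u\<in>keys p. lookup (snd u) j \<ge> 0" by blast
    have "ev gv (fmul f (fgen x)) = p \<star> gv x + av j \<star> (w \<star> gv x)"
      using gen by (simp add: ev_fmul[of _ "tgens n"] pw mul_add_left mul_assoc)
    then show ?case using D_add[OF D_gen[OF pw(2)] D_av] by simp
  next
    case (add f g)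
    then show ?case using D_add by (simp add: ev_fadd[of _ "tgens n"])
  qed
  then have "?D R" using assms unfolding img_def by blast
  then show thesis using that by blast
qed

text \<open>Multiplication by \<open>av j\<close> keeps the \<open>j\<close>-degree. Subtracting
  \<open>av j\<close> times the negative part of the cofactor therefore leaves an element whose
  terms have both negative and nonnegative degree, that is, zero.\<close>

lemma img_negative:
  assumes "R \<in> img" and neg: "\<And>u. u \<in> keys R \<Longrightarrow> lookup (snd u) j < 0"
  obtains w where "R = av j \<star> w"
proof -
  obtain p w where R: "R = p + av j \<star> w" and p: "\<And>u. u \<in> keys p \<Longrightarrow> lookup (snd u) j \<ge> 0"
    using img_decompose[OF assms(1)] by blast
  obtain w1 w2 where w: "w = w1 + w2" "keys w1 \<subseteq> {u. lookup (snd u) j < 0}"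
    "keys w2 \<inter> {u. lookup (snd u) j < 0} = {}" by (rule poly_mapping_split)
  have av: "lookup (snd (v + u)) j = lookup (snd u) j" if "v \<in> keys (av j)" for u v
    using that by (auto simp: keys_av lookup_add)
  define E where "E = R - av j \<star> w1"
  have E: "E = p + av j \<star> w2" by (simp add: E_def R w mul_add_right)
  have "keys E \<subseteq> keys R \<union> keys (av j \<star> w1)"
    by (auto simp: E_def in_keys_iff lookup_minus)
  moreover have "lookup (snd u) j < 0" if "u \<in> keys (av j \<star> w1)" for u
    using that by (rule keys_mul) (use av w(2) in auto)
  ultimately have neg: "lookup (snd u) j < 0" if "u \<in> keys E" for u
    using that neg by blast
  have "keys E \<subseteq> keys p \<union> keys (av j \<star> w2)"
    unfolding E by (rule keys_add)
  moreover have "lookup (snd u) j \<ge> 0" if "u \<in> keys (av j \<star> w2)" for u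
    using that by (rule keys_mul) (use av w(3) in \<open>auto simp: not_less disjoint_iff\<close>)
  ultimately have nonneg: "lookup (snd u) j \<ge> 0" if "u \<in> keys E" for u
    using that p by blast
  have "keys E = {}" using neg nonneg by fastforce
  then have "E = 0" by simp
  then show thesis using that[of w1] by (simp add: E_def)
qed

end

section \<open>Units of the image, multiples of \<open>av j\<close>, and images of the
  generators\<close>

context gwa_torus
begin

lemma av_not_single: "av j \<noteq> single u c"
proof
  assume "av j = single u c"
  then have "{(single j (int t), 0 :: expo), (single j (- int t), 0)} \<subseteq> {u}"
    by (metis keys_av keys_single empty_subsetI order_refl)
  then show False using t_pos by auto
qed

lemma av_nz: "av j \<noteq> 0"
  using keys_av[of j] by auto

text \<open>Factors of 1 are monomials with opposite exponents. A negative
  \<open>x\<^sub>j\<close>-degree in either would make a monomial a multiple of \<open>av j\<close>,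
  hence \<open>av j\<close> itself a monomial, which it is not; so all these degrees vanish.\<close>

lemma img_unit:
  assumes "U \<in> img" "V \<in> img" "U \<star> V = 1"
  obtains \<alpha> c where "c \<noteq> 0" "U = single (\<alpha>, 0) c" "V = single (- \<alpha>, 0) (inverse c)"
proof -
  obtain u a v b where uv: "a \<noteq> 0" "b \<noteq> 0" "U = single u a" "V = single v b"
    using mul_eq_single[of U V 0 1] assms(3) by (metis single_one zero_neq_one)
  have not_neg: "\<not> lookup (snd w) j < 0" if w: "single w c \<in> img" "c \<noteq> 0" for w c j
  proof
    assume "lookup (snd w) j < 0"
    then obtain w' where "single w c = av j \<star> w'"
      using img_negative[OF w(1)] w(2) by (metis keys_single singletonD)
    then show False
      by (metis av_not_single mul_eq_single w(2))
  qed
  have eq: "single (u + v) (a * b * q powi dot (snd u) (fst v)) = single 0 1"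
    using assms(3) by (simp add: uv mul_single)
  then have sum: "u + v = 0"
    using uv q_nz by (metis keys_single singletonD insertI1 mult_eq_0_iff powi_nz zero_neq_one)
  have "lookup (snd u) j = 0" for j
  proof -
    have "lookup (snd (u + v)) j = 0" using sum by simp
    then have "lookup (snd u) j + lookup (snd v) j = 0" by (simp add: lookup_add)
    then show ?thesis using not_neg[of u a j] not_neg[of v b j] assms uv by fastforce
  qed
  then have "snd u = 0" by (intro poly_mapping_eqI) simp
  moreover have v: "v = - u" using sum by (simp add: eq_neg_iff_add_eq_0 add.commute)
  ultimately have "single 0 (a * b) = (single 0 1 :: 'k torus)" using eq sum by simp
  then have "a * b = 1" by (simp only: single_eq_single_iff)
  then have "b = inverse a" using inverse_unique by metis
  moreover have "u = (fst u, 0)" "v = (- fst u, 0)"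
    using v \<open>snd u = 0\<close> by (auto simp: prod_eq_iff)
  ultimately show thesis using that[of a "fst u"] uv by simp
qed

text \<open>Factors of a homogeneous product are homogeneous, so no grading that vanishes on \<beta>
  can separate the two terms of \<open>av j\<close>. If \<beta> leaves the \<open>j\<close>-th axis,
  such a separating grading exists.\<close>

lemma binomial_direction:
  assumes eq: "av j \<star> W = single (\<beta>, 0) c + single (- \<beta>, 0) d"
    and "av j \<star> W \<noteq> 0"
  shows "\<exists>m. \<beta> = single j m"
proof -
  have "lookup \<beta> k = 0" if "k \<noteq> j" for k
  proof (rule ccontr)
    assume k: "lookup \<beta> k \<noteq> 0"
    define l where "l u = lookup \<beta> k * lookup (fst u) j - lookup \<beta> j * lookup (fst u) k"
      for u :: "expo \<times> expo" \<comment> \<open>a grading that vanishes on \<open>\<plusminus> \<beta>\<close> but separates the terms of \<open>av j\<close>\<close>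
    have add: "l (u + v) = l u + l v" for u v by (simp add: l_def lookup_add algebra_simps)
    have nz: "av j \<noteq> 0" "W \<noteq> 0"
      by (rule av_nz) (use assms(2) in auto)
    have "l s = 0" if "s \<in> keys (av j \<star> W)" for s
    proof -
      have "keys (single (\<beta>, 0) c + single (- \<beta>, 0 :: expo) d) \<subseteq> {(\<beta>, 0), (- \<beta>, 0)}"
        by (rule order_trans[OF keys_add]) (simp split: if_splits)
      then have "s = (\<beta>, 0) \<or> s = (- \<beta>, 0)"
        using that unfolding eq by blast
      then show ?thesis by (auto simp: l_def)
    qed
    then obtain a where "\<forall>u\<in>keys (av j). l u = a"
      using mul_homogeneous[OF nz add] by blast
    then have "l (single j (int t), 0) = l (single j (- int t), 0)" by (simp add: keys_av)
    then show False using k \<open>k \<noteq> j\<close> t_pos by (simp add: l_def lookup_single)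
  qed
  then have "\<beta> = single j (lookup \<beta> j)"
    by (intro poly_mapping_eqI) (auto simp: lookup_single when_def)
  then show ?thesis ..
qed

text \<open>For every additive degree, the top of \<open>av j\<close> plus the top of
  \<open>W\<close> is again a degree of a term of \<open>av j\<close>, so \<open>W\<close> has no
  positive degree. Using each coordinate and its negative, the exponents of \<open>W\<close>
  vanish.\<close>

lemma binomial_quotient:
  assumes eq: "av j \<star> W = Z" and Z: "keys Z = {(single j (int t), 0), (single j (- int t), 0)}"
  obtains c where "c \<noteq> 0" "W = single 0 c"
proof -
  have nz: "av j \<noteq> 0" "W \<noteq> 0" by (rule av_nz) (use assms in \<open>metis mul_zero(2) keys_zero insert_not_empty\<close>)
  have bound: "l w \<le> 0" if l: "\<And>u v. l (u + v) = l u + l v" and "w \<in> keys W"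
    for l :: "expo \<times> expo \<Rightarrow> int" and w
  proof -
    obtain u v where uv: "u \<in> keys (av j)" "v \<in> keys W" "u + v \<in> keys (av j \<star> W)"
      "\<And>x. x \<in> keys (av j) \<Longrightarrow> l x \<le> l u" "\<And>y. y \<in> keys W \<Longrightarrow> l y \<le> l v"
      using mul_max_degree[OF nz l] by blast
    have "u + v \<in> keys (av j)" using uv(3) by (simp add: eq Z keys_av)
    then have "l u + l v \<le> l u" using uv(4) l by metis
    then show ?thesis using uv(5)[OF \<open>w \<in> keys W\<close>] by linarith
  qed
  have zero: "l w = 0" if l: "\<And>u v. l (u + v) = l u + l v" and "w \<in> keys W"
    for l :: "expo \<times> expo \<Rightarrow> int" and w
    using bound[of l w, OF l] bound[of "\<lambda>u. - l u" w] l that(2) by force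
  have "w = 0" if "w \<in> keys W" for w
  proof (intro prod_eqI poly_mapping_eqI)
    show "lookup (fst w) i = lookup (fst 0) i" for i
      using zero[of "\<lambda>u. lookup (fst u) i" w] that by (simp add: lookup_add)
    show "lookup (snd w) i = lookup (snd 0) i" for i
      using zero[of "\<lambda>u. lookup (snd u) i" w] that by (simp add: lookup_add)
  qed
  then obtain u c where "c \<noteq> 0" "W = single u c"
    using single_if_coordinates_constant[OF nz(2)] by metis
  moreover then have "u = 0" using \<open>\<And>w. w \<in> keys W \<Longrightarrow> w = 0\<close> by simp
  ultimately show thesis using that by blast
qed

lemma keys_binomial:
  fixes \<beta> :: expo and c d :: 'k
  assumes "\<beta> \<noteq> 0" "c \<noteq> 0" "d \<noteq> 0"
  shows "keys (single (\<beta>, 0 :: expo) c + single (- \<beta>, 0) d) = {(\<beta>, 0), (- \<beta>, 0)}"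
proof -
  have "\<beta> \<noteq> - \<beta>"
  proof
    assume "\<beta> = - \<beta>"
    then have "lookup \<beta> i = - lookup \<beta> i" for i by (metis lookup_uminus)
    then have "lookup \<beta> i = 0" for i by (metis equal_neg_zero)
    then show False using assms(1) by (metis poly_mapping_eqI lookup_zero)
  qed
  then show ?thesis
    using assms by (auto simp: in_keys_iff lookup_add lookup_single when_def split: if_splits)
qed

text \<open>Applied with \<open>w\<close> the cofactor of \<open>av j\<close> in one generator image
  and \<open>R\<close> the other image, this turns both into monomials.\<close>

lemma divisible_factor:
  assumes "w \<star> R = single 0 c" "c \<noteq> 0"
    and "\<And>u. u \<in> keys R \<Longrightarrow> snd u = d"
  obtains \<beta> \<beta>' b b' where "b \<noteq> 0" "b' \<noteq> 0" "R = single (\<beta>, d) b" "w = single (\<beta>', - d) b'"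
proof -
  obtain u a v b where uv: "a \<noteq> 0" "b \<noteq> 0" "w = single u a" "R = single v b"
    using mul_eq_single[OF assms(1,2)] by metis
  have "single (u + v) (a * b * q powi dot (snd u) (fst v)) = single 0 c"
    using assms(1) by (simp add: uv mul_single)
  then have "u + v = 0"
    using assms(2) by (metis keys_single singletonD insertI1 single_eq_0_iff)
  then have u: "snd u = - snd v" by (metis add_eq_0_iff snd_add snd_zero add.commute)
  have "snd v = d" using assms(3) uv by simp
  then have "v = (fst v, d)" "u = (fst u, - d)" using u by (auto simp: prod_eq_iff)
  then show thesis using that[of b a "fst v" "fst u"] uv by metis
qed

text \<open>\<open>P\<close>, \<open>Q\<close> and \<open>single (\<alpha>, 0) c\<close> stand for
  the images of \<open>Psi\<close>, \<open>Psid\<close> and \<open>Om\<close> of one factor, and the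
  hypotheses are the images of its defining relations. The sign \<epsilon> is 1 if
  \<open>Psi\<close> and \<open>Psid\<close> keep their roles and -1 if they are swapped.\<close>

lemma image_of_generators:
  assumes P: "P \<in> img" and Q: "Q \<in> img" and W: "single (\<alpha>, 0) c \<in> img" and c: "c \<noteq> 0"
    and PW: "P \<star> single (\<alpha>, 0) c = single 0 q \<star> (single (\<alpha>, 0) c \<star> P)"
    and QW: "Q \<star> single (\<alpha>, 0) c = single 0 (inverse q) \<star> (single (\<alpha>, 0) c \<star> Q)"
    and PQ: "P \<star> Q = single 0 kappa \<star> (single 0 (q ^ t) \<star> single (frag_cmul (int t) \<alpha>, 0) (c ^ t)
                - single 0 (inverse q ^ t) \<star> single (frag_cmul (int t) (- \<alpha>), 0) (inverse c ^ t))"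
    and QP: "Q \<star> P = single 0 kappa \<star> (single (frag_cmul (int t) \<alpha>, 0) (c ^ t)
                - single (frag_cmul (int t) (- \<alpha>), 0) (inverse c ^ t))"
  obtains j \<epsilon> where "j < n" "\<epsilon> * \<epsilon> = 1" "\<alpha> = single j \<epsilon>"
    "P \<noteq> 0" "Q \<noteq> 0" "\<And>u. u \<in> keys P \<Longrightarrow> snd u = single j \<epsilon>" "\<And>u. u \<in> keys Q \<Longrightarrow> snd u = - single j \<epsilon>"
    "\<exists>b b' \<beta> \<beta>'. b \<noteq> 0 \<and> b' \<noteq> 0 \<and>
      (P = single (\<beta>, single j 1) b \<and> Q = av j \<star> single (\<beta>', - single j 1) b' \<or>
       Q = single (\<beta>, single j 1) b \<and> P = av j \<star> single (\<beta>', - single j 1) b')"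
proof -
  define \<beta> where "\<beta> = frag_cmul (int t) \<alpha>"
  define A B where "A = kappa * q ^ t * c ^ t" and "B = - (kappa * inverse q ^ t * inverse c ^ t)"
  define C D where "C = kappa * c ^ t" and "D = - (kappa * inverse c ^ t)"
  have coeff_nz: "A \<noteq> 0" "B \<noteq> 0" "C \<noteq> 0" "D \<noteq> 0"
    using kappa_nz q_nz c by (simp_all add: A_def B_def C_def D_def)
  have minus: "frag_cmul (int t) (- \<alpha>) = - \<beta>"
    unfolding \<beta>_def by (rule poly_mapping_eqI) simp
  have PQ': "P \<star> Q = single (\<beta>, 0) A + single (- \<beta>, 0) B"
    unfolding PQ minus by (simp add: \<beta>_def[symmetric] mul_diff_right mul_single A_def B_def
        mult.assoc single_uminus)
  have QP': "Q \<star> P = single (\<beta>, 0) C + single (- \<beta>, 0) D"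
    unfolding QP minus by (simp add: \<beta>_def[symmetric] mul_diff_right mul_single C_def D_def
        mult.assoc single_uminus)
  \<comment> \<open>At this point \<alpha> could still be 0 and the two terms of each binomial could
    merge. So the second term is eliminated between the two products instead, leaving a nonzero
    multiple of \<open>q^t - q^(-t)\<close>.\<close>
  have PQ_nz: "P \<noteq> 0" "Q \<noteq> 0"
  proof -
    have False if "P \<star> Q = 0" "Q \<star> P = 0"
    proof -
      have "single (- \<beta>, 0 :: expo) D = - single (\<beta>, 0) C"
        using that(2) QP' by (simp add: eq_neg_iff_add_eq_0 add.commute)
      then have "single 0 (inverse q ^ t) \<star> single (- \<beta>, 0 :: expo) D
          = single 0 (inverse q ^ t) \<star> (- single (\<beta>, 0) C)" by simp
      then have "single (- \<beta>, 0 :: expo) B = - single (\<beta>, 0) (inverse q ^ t * C)"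
        by (simp add: mul_minus_right mul_single B_def D_def mult_ac)
      then have "single (\<beta>, 0 :: expo) (A - inverse q ^ t * C) = 0"
        using that(1) PQ' by (simp add: single_diff)
      then have "A = inverse q ^ t * C" by simp
      then have "kappa * c ^ t * (q ^ t - inverse q ^ t) = 0" by (simp add: A_def C_def algebra_simps)
      then show False using kappa_nz c by auto
    qed
    then show "P \<noteq> 0" "Q \<noteq> 0" by force+
  qed
  have Pq: "dot (snd v) \<alpha> = 1" if "v \<in> keys P" for v
    using q_commuteD[of P "(\<alpha>, 0)" c 1 v] PW c that by simp
  have Qq: "dot (snd v) \<alpha> = - 1" if "v \<in> keys Q" for v
    using q_commuteD[of Q "(\<alpha>, 0)" c "- 1" v] QW c that by (simp add: power_int_minus)
  obtain v0 where v0: "v0 \<in> keys P" using PQ_nz by (metis all_not_in_conv keys_eq_empty)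
  define d where "d = snd v0"
  have "\<alpha> \<noteq> 0" using Pq[OF v0] by auto
  then have \<beta>_nz: "\<beta> \<noteq> 0" using t_pos by (simp add: \<beta>_def)
  have nz: "P \<star> Q \<noteq> 0" "Q \<star> P \<noteq> 0" using mul_max_key PQ_nz by blast+
  have homog: "lookup (snd u) i = lookup d i" "v \<in> keys Q \<Longrightarrow> lookup (snd v) i = - lookup d i"
    if "u \<in> keys P" for u v i
  proof -
    define l where "l u = lookup (snd u) i" for u :: "expo \<times> expo"
    have l_add: "l (u + v) = l u + l v" for u v by (simp add: l_def lookup_add)
    have "l s = 0" if "s \<in> keys (P \<star> Q)" for s
    proof -
      have "keys (single (\<beta>, 0) A + single (- \<beta>, 0 :: expo) B) \<subseteq> {(\<beta>, 0), (- \<beta>, 0)}"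
        by (rule order_trans[OF keys_add]) (simp split: if_splits)
      then have "s = (\<beta>, 0) \<or> s = (- \<beta>, 0)"
        using that unfolding PQ' by blast
      then show ?thesis by (auto simp: l_def)
    qed
    then obtain a where a: "\<forall>u\<in>keys P. l u = a" "\<forall>u\<in>keys Q. l u = 0 - a"
      using mul_homogeneous[OF PQ_nz l_add] by blast
    then have "a = lookup d i" using v0 by (auto simp: l_def d_def)
    then show "lookup (snd u) i = lookup d i" "v \<in> keys Q \<Longrightarrow> lookup (snd v) i = - lookup d i"
      using a that by (auto simp: l_def)
  qed
  have P_deg: "snd u = d" if "u \<in> keys P" for u
    using homog(1)[OF that] by (rule poly_mapping_eqI)
  have Q_deg: "snd u = - d" if "u \<in> keys Q" for u
    using homog(2)[OF v0 that] by (intro poly_mapping_eqI) simp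
  \<comment> \<open>Whichever of \<open>P\<close> and \<open>Q\<close> has negative
    \<open>x\<^sub>j\<close>-degree is a left multiple of \<open>av j\<close>, and so is the product
    that starts with it; hence both orders of the product enter.\<close>
  have dir: "\<exists>m. \<alpha> = single j m" if dj: "lookup d j \<noteq> 0" for j
  proof -
    have "\<exists>m. \<beta> = single j m"
    proof (cases "lookup d j > 0")
      case True
      then obtain w where w: "Q = av j \<star> w"
        using img_negative[OF Q, of j] Q_deg by auto
      then show ?thesis
        using binomial_direction[of j "w \<star> P" \<beta> C D] QP' nz by (simp add: mul_assoc)
    next
      case False
      then obtain w where w: "P = av j \<star> w"
        using img_negative[OF P, of j] P_deg dj by auto
      then show ?thesis
        using binomial_direction[of j "w \<star> Q" \<beta> A B] PQ' nz by (simp add: mul_assoc)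
    qed
    then obtain m where m: "\<beta> = single j m" by blast
    have "lookup \<alpha> i = 0" if "i \<noteq> j" for i
      using arg_cong[OF m, of "\<lambda>b. lookup b i"] that t_pos
      by (simp add: \<beta>_def lookup_single)
    then have "\<alpha> = single j (lookup \<alpha> j)"
      by (intro poly_mapping_eqI) (auto simp: lookup_single when_def)
    then show ?thesis ..
  qed
  have "d \<noteq> 0" using Pq[OF v0] by (auto simp: d_def)
  then obtain j where j: "lookup d j \<noteq> 0" by (metis poly_mapping_eqI lookup_zero)
  obtain \<epsilon> where \<epsilon>: "\<alpha> = single j \<epsilon>" using dir[OF j] by blast
  \<comment> \<open>A second nonzero coordinate of \<open>d\<close> would put \<alpha> on a second
    axis as well, which is impossible for a nonzero vector.\<close>
  have d_single: "d = single j (lookup d j)"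
  proof (rule poly_mapping_eqI)
    fix i
    have "lookup d i = 0" if "i \<noteq> j"
    proof (rule ccontr)
      assume "lookup d i \<noteq> 0"
      then obtain m where "single j \<epsilon> = single i m" using dir \<epsilon> by blast
      then have "lookup (single j \<epsilon>) j = lookup (single i m) j" by simp
      then show False using \<open>\<alpha> \<noteq> 0\<close> \<epsilon> that by (simp add: lookup_single)
    qed
    then show "lookup d i = lookup (single j (lookup d j)) i"
      by (auto simp: lookup_single when_def)
  qed
  have prod: "lookup d j * \<epsilon> = 1" using Pq[OF v0] by (simp add: \<epsilon> d_def)
  then have \<epsilon>_cases: "\<epsilon> = 1 \<and> lookup d j = 1 \<or> \<epsilon> = - 1 \<and> lookup d j = - 1"
    using pos_zmult_eq_1_iff_lemma zmult_eq_1_iff by auto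
  then have d: "d = single j \<epsilon>" using d_single by auto
  have "j < n"
  proof (rule ccontr)
    assume "\<not> j < n"
    then have "lookup \<alpha> j = 0" using img_support[OF W, of "(\<alpha>, 0)" j] c by simp
    then show False using \<epsilon> \<epsilon>_cases by auto
  qed
  \<comment> \<open>Since \<epsilon> is a sign, the product has exactly the exponents of
    \<open>av j\<close>, up to their order, as \<open>binomial_quotient\<close> requires.\<close>
  have \<beta>_set: "{(\<beta>, 0 :: expo), (- \<beta>, 0)} = {(single j (int t), 0), (single j (- int t), 0)}"
    using \<epsilon>_cases by (auto simp: \<beta>_def \<epsilon> single_uminus)
  have "\<exists>b b' \<beta> \<beta>'. b \<noteq> 0 \<and> b' \<noteq> 0 \<and>
      (P = single (\<beta>, single j 1) b \<and> Q = av j \<star> single (\<beta>', - single j 1) b' \<or>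
       Q = single (\<beta>, single j 1) b \<and> P = av j \<star> single (\<beta>', - single j 1) b')"
    using \<epsilon>_cases
  proof
    assume *: "\<epsilon> = 1 \<and> lookup d j = 1"
    then obtain w where w: "Q = av j \<star> w"
      using img_negative[OF Q, of j] Q_deg by auto
    obtain e where "e \<noteq> 0" "w \<star> P = single 0 e"
      using binomial_quotient[of j "w \<star> P" "Q \<star> P"] w QP' keys_binomial[OF \<beta>_nz coeff_nz(3,4)] \<beta>_set
      by (metis mul_assoc)
    then obtain \<gamma> \<gamma>' b b' where "b \<noteq> 0" "b' \<noteq> 0" "P = single (\<gamma>, single j 1) b" "w = single (\<gamma>', - single j 1) b'"
      using divisible_factor[of w P e d] P_deg d * by metis
    then show ?thesis using w by blast
  next
    assume *: "\<epsilon> = - 1 \<and> lookup d j = - 1"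
    then obtain w where w: "P = av j \<star> w"
      using img_negative[OF P, of j] P_deg by auto
    obtain e where "e \<noteq> 0" "w \<star> Q = single 0 e"
      using binomial_quotient[of j "w \<star> Q" "P \<star> Q"] w PQ' keys_binomial[OF \<beta>_nz coeff_nz(1,2)] \<beta>_set
      by (metis mul_assoc)
    moreover have "- d = single j 1" using d * by (simp add: single_uminus)
    ultimately obtain \<gamma> \<gamma>' b b' where "b \<noteq> 0" "b' \<noteq> 0" "Q = single (\<gamma>, single j 1) b" "w = single (\<gamma>', - single j 1) b'"
      using divisible_factor[of w Q e "- d"] Q_deg by metis
    then show ?thesis using w by blast
  qed
  then show thesis
    using that[of j \<epsilon>] \<open>j < n\<close> \<epsilon>_cases \<epsilon> PQ_nz P_deg Q_deg d by auto
qed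

end

section \<open>Normal monomials\<close>

text \<open>The presentation in abstract form: scalars, generators, relations, and generation by
  left multiplication (\<open>gen_induct\<close>). The normal form argument can then ignore
  cosets.\<close>

locale gwa_algebra = ring A for A (structure) +
  fixes q :: "'k::field" and t n :: nat
    and sc :: "'k \<Rightarrow> 'a" and g :: "nat \<Rightarrow> hgen \<Rightarrow> 'a"
  assumes q_nonzero: "q \<noteq> 0"
    and sc_closed [simp]: "sc c \<in> carrier A"
    and sc_add: "sc (c + c') = sc c \<oplus> sc c'"
    and sc_mult: "sc (c * c') = sc c \<otimes> sc c'"
    and sc_one: "sc 1 = \<one>"
    and sc_central: "x \<in> carrier A \<Longrightarrow> x \<otimes> sc c = sc c \<otimes> x"
    and g_closed [simp]: "i < n \<Longrightarrow> g i a \<in> carrier A"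
    and Om_Omi: "i < n \<Longrightarrow> g i Om \<otimes> g i Omi = \<one>"
    and Omi_Om: "i < n \<Longrightarrow> g i Omi \<otimes> g i Om = \<one>"
    and Psi_Om: "i < n \<Longrightarrow> g i Psi \<otimes> g i Om = sc q \<otimes> (g i Om \<otimes> g i Psi)"
    and Psid_Om: "i < n \<Longrightarrow> g i Psid \<otimes> g i Om = sc (inverse q) \<otimes> (g i Om \<otimes> g i Psid)"
    and Psi_Psid: "i < n \<Longrightarrow> g i Psi \<otimes> g i Psid = sc (inverse (q ^ t - inverse q ^ t)) \<otimes>
      (sc (q ^ t) \<otimes> g i Om [^] t \<ominus> sc (inverse q ^ t) \<otimes> g i Omi [^] t)"
    and Psid_Psi: "i < n \<Longrightarrow> g i Psid \<otimes> g i Psi = sc (inverse (q ^ t - inverse q ^ t)) \<otimes>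
      (g i Om [^] t \<ominus> g i Omi [^] t)"
    and g_commute: "i < n \<Longrightarrow> j < n \<Longrightarrow> i \<noteq> j \<Longrightarrow> g i a \<otimes> g j b = g j b \<otimes> g i a"
    and gen_induct: "x \<in> carrier A \<Longrightarrow> (\<And>c. S (sc c))
      \<Longrightarrow> (\<And>x i a. x \<in> carrier A \<Longrightarrow> S x \<Longrightarrow> i < n \<Longrightarrow> S (g i a \<otimes> x))
      \<Longrightarrow> (\<And>x y. x \<in> carrier A \<Longrightarrow> S x \<Longrightarrow> y \<in> carrier A \<Longrightarrow> S y \<Longrightarrow> S (x \<oplus> y)) \<Longrightarrow> S x"
begin

text \<open>The linear span, with scalars acting through \<open>sc\<close>. Adding one term at a
  time postpones coefficient families to \<open>normal_form\<close>.\<close>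

inductive_set lspan :: "'a set \<Rightarrow> 'a set" for B where
  zero: "\<zero> \<in> lspan B"
| add: "b \<in> B \<Longrightarrow> x \<in> lspan B \<Longrightarrow> sc c \<otimes> b \<oplus> x \<in> lspan B"

declare pow_nat [simp del]

lemma pow_Suc_left: "x \<in> carrier A \<Longrightarrow> x \<otimes> x [^] (m::nat) = x [^] Suc m"
  by (simp only: nat_pow_Suc2)

lemma sc_left_commute:
  "x \<in> carrier A \<Longrightarrow> y \<in> carrier A \<Longrightarrow> x \<otimes> (sc c \<otimes> y) = sc c \<otimes> (x \<otimes> y)"
  by (simp add: sc_central flip: m_assoc)

lemma lspan_closed: "B \<subseteq> carrier A \<Longrightarrow> x \<in> lspan B \<Longrightarrow> x \<in> carrier A"
  by (erule lspan.induct) auto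

lemma lspan_add:
  assumes "B \<subseteq> carrier A" "x \<in> lspan B" "y \<in> lspan B" shows "x \<oplus> y \<in> lspan B"
  using assms(2)
proof induction
  case zero
  then show ?case using assms lspan_closed by auto
next
  case (add b x c)
  then have "b \<in> carrier A" "x \<in> carrier A" "y \<in> carrier A" using assms lspan_closed by auto
  then have "sc c \<otimes> b \<oplus> x \<oplus> y = sc c \<otimes> b \<oplus> (x \<oplus> y)" by (simp add: a_assoc)
  then show ?case using add lspan.add by simp
qed

lemma lspan_scale:
  assumes "B \<subseteq> carrier A" "x \<in> lspan B" shows "sc c \<otimes> x \<in> lspan B"
  using assms(2)
proof induction
  case zero
  then show ?case by (simp add: lspan.zero)
next
  case (add b x c')
  then have "b \<in> carrier A" "x \<in> carrier A" using assms lspan_closed by auto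
  then have "sc c \<otimes> (sc c' \<otimes> b \<oplus> x) = sc (c * c') \<otimes> b \<oplus> sc c \<otimes> x"
    by (simp add: r_distr sc_mult m_assoc)
  then show ?case using add lspan.add by simp
qed

lemma lspan_base:
  assumes "B \<subseteq> carrier A" "b \<in> B" shows "b \<in> lspan B"
  using lspan.add[OF assms(2) lspan.zero, of 1] assms by (auto simp: sc_one subset_iff)

lemma sc_zero: "sc 0 = \<zero>"
  using sc_add[of 0 0] r_neg1[of "sc 0" "sc 0"] l_neg[of "sc 0"] by simp

lemma sc_minus_one:
  assumes "x \<in> carrier A" shows "sc (- 1) \<otimes> x = \<ominus> x"
proof -
  have "sc (- 1) \<otimes> x \<oplus> x = (sc (- 1) \<oplus> sc 1) \<otimes> x" using assms by (simp add: l_distr sc_one)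
  also have "\<dots> = \<zero>" using assms by (simp add: sc_zero flip: sc_add)
  finally show ?thesis using assms by (metis minus_equality m_closed sc_closed)
qed

lemma lspan_minus:
  assumes "B \<subseteq> carrier A" "x \<in> lspan B" "y \<in> lspan B" shows "x \<ominus> y \<in> lspan B"
  using lspan_add[OF assms(1,2) lspan_scale[OF assms(1,3), of "- 1"]] assms lspan_closed
  by (simp add: sc_minus_one minus_eq)

lemma lspan_mult_left:
  assumes "B \<subseteq> carrier A" "B' \<subseteq> carrier A" "y \<in> carrier A"
    and "\<And>b. b \<in> B \<Longrightarrow> y \<otimes> b \<in> lspan B'" and "x \<in> lspan B"
  shows "y \<otimes> x \<in> lspan B'"
  using assms(5)
proof induction
  case zero
  then show ?case using assms by (simp add: lspan.zero)
next
  case (add b x c)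
  then have *: "b \<in> carrier A" "x \<in> carrier A" using assms lspan_closed by auto
  then have "y \<otimes> (sc c \<otimes> b \<oplus> x) = sc c \<otimes> (y \<otimes> b) \<oplus> y \<otimes> x"
    using assms(3) by (simp add: r_distr sc_central flip: m_assoc)
  then show ?case using add assms lspan_add lspan_scale by simp
qed

lemma lspan_mult_right:
  assumes "B \<subseteq> carrier A" "B' \<subseteq> carrier A" "y \<in> carrier A"
    and "\<And>b. b \<in> B \<Longrightarrow> b \<otimes> y \<in> lspan B'" and "x \<in> lspan B"
  shows "x \<otimes> y \<in> lspan B'"
  using assms(5)
proof induction
  case zero
  then show ?case using assms by (simp add: lspan.zero)
next
  case (add b x c)
  then have *: "b \<in> carrier A" "x \<in> carrier A" using assms lspan_closed by auto
  then have "(sc c \<otimes> b \<oplus> x) \<otimes> y = sc c \<otimes> (b \<otimes> y) \<oplus> x \<otimes> y"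
    using assms(3) by (simp add: l_distr m_assoc)
  then show ?case using add assms lspan_add lspan_scale by simp
qed

text \<open>A normal monomial of one factor is an integer power of \<open>Om\<close> times a pure
  power of \<open>Psi\<close> or of \<open>Psid\<close>; mixed products of the latter reduce to
  Laurent polynomials in \<open>Om\<close>.\<close>

definition Zp :: "nat \<Rightarrow> int \<Rightarrow> 'a" where
  "Zp i b = (if b \<ge> 0 then g i Om [^] nat b else g i Omi [^] nat (- b))"

definition Vp :: "nat \<Rightarrow> int \<Rightarrow> 'a" where
  "Vp i e = (if e \<ge> 0 then g i Psi [^] nat e else g i Psid [^] nat (- e))"

definition Mp :: "nat \<Rightarrow> int \<times> int \<Rightarrow> 'a" where
  "Mp i p = Zp i (fst p) \<otimes> Vp i (snd p)"

primrec Np :: "nat \<Rightarrow> (nat \<Rightarrow> int \<times> int) \<Rightarrow> 'a" where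
  "Np 0 k = \<one>"
| "Np (Suc m) k = Np m k \<otimes> Mp m (k m)"

text \<open>Exponents are cut off beyond \<open>m\<close>, so that distinct elements of \<open>Ks m\<close> give distinct monomials.\<close>

definition Ks :: "nat \<Rightarrow> (nat \<Rightarrow> int \<times> int) set" where
  "Ks m = {k. \<forall>i\<ge>m. k i = (0, 0)}"

lemma Zp_closed [simp]: "i < n \<Longrightarrow> Zp i b \<in> carrier A"
  by (simp add: Zp_def)

lemma Vp_closed [simp]: "i < n \<Longrightarrow> Vp i b \<in> carrier A"
  by (simp add: Vp_def)

lemma Mp_closed [simp]: "i < n \<Longrightarrow> Mp i p \<in> carrier A"
  by (simp add: Mp_def)

lemma Np_closed [simp]: "m \<le> n \<Longrightarrow> Np m k \<in> carrier A"
  by (induction m) simp_all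

lemma Np_cong: "(\<And>i. i < m \<Longrightarrow> k i = k' i) \<Longrightarrow> Np m k = Np m k'"
  by (induction m) simp_all

lemma cancel_pow:
  assumes "x \<in> carrier A" "y \<in> carrier A" "x \<otimes> y = \<one>"
  shows "x \<otimes> y [^] Suc m = y [^] m"
  using assms by (simp only: nat_pow_Suc2) (simp flip: m_assoc)

lemma int_Suc_cases:
  obtains m where "(b::int) = int m" | m where "b = - int (Suc m)"
  by (metis int_cases)

section \<open>Normal monomials span the algebra\<close>

lemma Om_Zp: "i < n \<Longrightarrow> g i Om \<otimes> Zp i b = Zp i (b + 1)"
proof (cases b rule: int_Suc_cases)
  case (1 m)
  then have "nat (b + 1) = Suc m" "nat b = m" by simp_all
  moreover assume "i < n"
  ultimately show ?thesis using 1 by (simp add: Zp_def pow_Suc_left del: nat_pow_Suc)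
next
  case (2 m)
  moreover assume "i < n"
  moreover have "nat (- (b + 1)) = m" "nat (- b) = Suc m" using 2 by simp_all
  ultimately show ?thesis
    using cancel_pow[of "g i Om" "g i Omi" m] by (cases "m = 0") (simp_all add: Zp_def Om_Omi)
qed

lemma Omi_Zp: "i < n \<Longrightarrow> g i Omi \<otimes> Zp i b = Zp i (b - 1)"
proof -
  assume i: "i < n"
  have "g i Omi \<otimes> Zp i b = g i Omi \<otimes> (g i Om \<otimes> Zp i (b - 1))"
    using Om_Zp[OF i, of "b - 1"] by simp
  also have "\<dots> = Zp i (b - 1)" using i by (simp add: Omi_Om flip: m_assoc)
  finally show ?thesis .
qed

lemma q_commute_pow:
  assumes "x \<in> carrier A" "y \<in> carrier A" "x \<otimes> y = sc c \<otimes> (y \<otimes> x)"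
  shows "x \<otimes> y [^] (m::nat) = sc (c ^ m) \<otimes> (y [^] m \<otimes> x)"
proof (induction m)
  case 0
  then show ?case using assms by (simp add: sc_one)
next
  case (Suc m)
  have "x \<otimes> y [^] Suc m = (x \<otimes> y [^] m) \<otimes> y" using assms by (simp add: m_assoc)
  also have "\<dots> = sc (c ^ m) \<otimes> (y [^] m \<otimes> (x \<otimes> y))"
    unfolding Suc using assms(1,2) by (simp add: m_assoc)
  also have "\<dots> = sc (c ^ m) \<otimes> (sc c \<otimes> (y [^] m \<otimes> (y \<otimes> x)))"
    unfolding assms(3) using assms(1,2) by (simp add: sc_left_commute[of "y [^] m"])
  also have "\<dots> = sc (c ^ Suc m) \<otimes> (y [^] Suc m \<otimes> x)"
    using assms(1,2) by (simp add: m_assoc mult.commute[of c] sc_mult)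
  finally show ?case .
qed

text \<open>The relation with \<open>Om\<close> is multiplied by \<open>Omi\<close> from both
  sides.\<close>

lemma q_commute_inverse:
  assumes "i < n" "x \<in> carrier A" "c \<noteq> 0" "x \<otimes> g i Om = sc c \<otimes> (g i Om \<otimes> x)"
  shows "x \<otimes> g i Omi = sc (inverse c) \<otimes> (g i Omi \<otimes> x)"
proof -
  have "g i Omi \<otimes> (x \<otimes> g i Om) \<otimes> g i Omi = g i Omi \<otimes> (sc c \<otimes> (g i Om \<otimes> x)) \<otimes> g i Omi"
    using assms by simp
  moreover have "g i Omi \<otimes> (x \<otimes> g i Om) \<otimes> g i Omi = g i Omi \<otimes> x"
    using assms(1,2) by (simp add: m_assoc Om_Omi)
  moreover have "g i Omi \<otimes> (sc c \<otimes> (g i Om \<otimes> x)) \<otimes> g i Omi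
      = sc c \<otimes> (g i Omi \<otimes> g i Om) \<otimes> (x \<otimes> g i Omi)"
  proof -
    have "g i Omi \<otimes> (sc c \<otimes> (g i Om \<otimes> x)) = sc c \<otimes> (g i Omi \<otimes> g i Om \<otimes> x)"
      using assms(1,2) by (simp add: sc_left_commute[of "g i Omi"] m_assoc)
    then show ?thesis using assms(1,2) by (simp only: g_closed sc_closed m_closed m_assoc)
  qed
  ultimately have "g i Omi \<otimes> x = sc c \<otimes> (x \<otimes> g i Omi)" using assms by (simp add: Omi_Om)
  then have "sc (inverse c) \<otimes> (g i Omi \<otimes> x) = sc (inverse c * c) \<otimes> (x \<otimes> g i Omi)"
    unfolding sc_mult using assms(1,2) by (simp add: m_assoc)
  then show ?thesis using assms(1,2,3) by (simp add: sc_one)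
qed

text \<open>The value of \<open>c'\<close> is left open because a span only needs some
  scalar.\<close>

lemma q_commute_Zp:
  assumes "i < n" "x \<in> carrier A" "c \<noteq> 0" "x \<otimes> g i Om = sc c \<otimes> (g i Om \<otimes> x)"
  obtains c' where "x \<otimes> Zp i b = sc c' \<otimes> (Zp i b \<otimes> x)"
proof (cases "b \<ge> 0")
  case True
  then show thesis using that q_commute_pow[OF _ _ assms(4)] assms(1,2) by (simp add: Zp_def)
next
  case False
  then show thesis
    using that q_commute_pow[OF _ _ q_commute_inverse[OF assms]] assms(1,2) by (simp add: Zp_def)
qed

lemma range_Mp_closed:
  assumes "i < n" shows "range (Mp i) \<subseteq> carrier A"
  using assms by auto

lemma Om_lspan:
  assumes "i < n" "x \<in> lspan (range (Mp i))"
  shows "g i Om \<otimes> x \<in> lspan (range (Mp i))" "g i Omi \<otimes> x \<in> lspan (range (Mp i))"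
proof -
  note B = range_Mp_closed[OF assms(1)]
  have "g i Om \<otimes> Mp i p = Mp i (fst p + 1, snd p)" "g i Omi \<otimes> Mp i p = Mp i (fst p - 1, snd p)" for p
    using assms(1) by (simp_all add: Mp_def Om_Zp Omi_Zp flip: m_assoc)
  then have "g i Om \<otimes> b \<in> lspan (range (Mp i))" "g i Omi \<otimes> b \<in> lspan (range (Mp i))"
    if "b \<in> range (Mp i)" for b
    using that lspan_base[OF B] by auto
  then show "g i Om \<otimes> x \<in> lspan (range (Mp i))" "g i Omi \<otimes> x \<in> lspan (range (Mp i))"
    using lspan_mult_left[OF B B _ _ assms(2)] assms(1) by auto
qed

lemma pow_lspan:
  assumes "y \<in> carrier A" "B \<subseteq> carrier A" "\<And>x. x \<in> lspan B \<Longrightarrow> y \<otimes> x \<in> lspan B" "x \<in> lspan B"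
  shows "y [^] (m::nat) \<otimes> x \<in> lspan B"
proof (induction m)
  case 0
  then show ?case using assms lspan_closed by simp
next
  case (Suc m)
  have "x \<in> carrier A" using assms lspan_closed by blast
  then have "y [^] Suc m \<otimes> x = y \<otimes> (y [^] m \<otimes> x)"
    using assms(1) by (simp only: nat_pow_Suc2) (simp add: m_assoc)
  then show ?case using Suc assms(3) by simp
qed

lemma Om_pow_lspan:
  assumes "i < n" "x \<in> lspan (range (Mp i))"
  shows "g i Om [^] (m::nat) \<otimes> x \<in> lspan (range (Mp i))"
    and "g i Omi [^] (m::nat) \<otimes> x \<in> lspan (range (Mp i))"
    and "Zp i b \<otimes> x \<in> lspan (range (Mp i))"
proof -
  note B = range_Mp_closed[OF assms(1)]
  show *: "g i Om [^] (m::nat) \<otimes> x \<in> lspan (range (Mp i))"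
    "g i Omi [^] (m::nat) \<otimes> x \<in> lspan (range (Mp i))" for m
    using Om_lspan assms by (auto intro!: pow_lspan[OF _ B])
  show "Zp i b \<otimes> x \<in> lspan (range (Mp i))"
    using * by (simp add: Zp_def)
qed

lemma Vp_lspan:
  assumes "i < n" shows "Vp i e \<in> lspan (range (Mp i))"
proof -
  have "Mp i (0, e) = Vp i e" using assms by (simp add: Mp_def Zp_def)
  then show ?thesis using lspan_base[OF range_Mp_closed[OF assms]] by (metis rangeI)
qed

text \<open>If the generator and the exponent have matching signs, the exponent just grows in size.
  Otherwise a leading \<open>Psi\<close>-\<open>Psid\<close> pair is replaced by a Laurent
  polynomial in \<open>Om\<close>, and the span is closed under left multiplication by such
  polynomials.\<close>

lemma Psi_Vp_lspan:
  assumes i: "i < n"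
  shows "g i Psi \<otimes> Vp i e \<in> lspan (range (Mp i))" "g i Psid \<otimes> Vp i e \<in> lspan (range (Mp i))"
proof -
  note B = range_Mp_closed[OF i]
  note closure = lspan_scale[OF B] lspan_minus[OF B] Om_pow_lspan[OF i] Vp_lspan[OF i]
  have PsiPsid: "g i Psi \<otimes> (g i Psid \<otimes> x) \<in> lspan (range (Mp i))"
    and PsidPsi: "g i Psid \<otimes> (g i Psi \<otimes> x) \<in> lspan (range (Mp i))"
    if x: "x \<in> lspan (range (Mp i))" for x
  proof -
    have xc: "x \<in> carrier A" using lspan_closed[OF B] x by blast
    have "g i Psi \<otimes> (g i Psid \<otimes> x) = sc (inverse (q ^ t - inverse q ^ t)) \<otimes>
      (sc (q ^ t) \<otimes> (g i Om [^] t \<otimes> x) \<ominus> sc (inverse q ^ t) \<otimes> (g i Omi [^] t \<otimes> x))"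
      using i xc by (simp add: Psi_Psid m_assoc[symmetric])
        (simp add: m_assoc minus_eq l_distr l_minus)
    then show "g i Psi \<otimes> (g i Psid \<otimes> x) \<in> lspan (range (Mp i))" using closure x by simp
    have "g i Psid \<otimes> (g i Psi \<otimes> x) = sc (inverse (q ^ t - inverse q ^ t)) \<otimes>
      (g i Om [^] t \<otimes> x \<ominus> g i Omi [^] t \<otimes> x)"
      using i xc by (simp add: Psid_Psi m_assoc[symmetric])
        (simp add: m_assoc minus_eq l_distr l_minus)
    then show "g i Psid \<otimes> (g i Psi \<otimes> x) \<in> lspan (range (Mp i))" using closure x by simp
  qed
  show "g i Psi \<otimes> Vp i e \<in> lspan (range (Mp i))"
  proof (cases e rule: int_Suc_cases)
    case (1 m)
    then have "nat (e + 1) = Suc m" "nat e = m" by simp_all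
    then have "g i Psi \<otimes> Vp i e = Vp i (e + 1)"
      using i 1 by (simp add: Vp_def pow_Suc_left del: nat_pow_Suc)
    then show ?thesis using closure by simp
  next
    case (2 m)
    then have m: "nat (- (e + 1)) = m" "nat (- e) = Suc m" by simp_all
    have "Vp i e = g i Psid \<otimes> Vp i (e + 1)"
      using i 2 m by (cases "m = 0") (simp_all add: Vp_def pow_Suc_left del: nat_pow_Suc)
    then show ?thesis using PsiPsid closure by simp
  qed
  show "g i Psid \<otimes> Vp i e \<in> lspan (range (Mp i))"
  proof (cases "e > 0")
    case False
    then have "nat (- (e - 1)) = Suc (nat (- e))" by simp
    then have "g i Psid \<otimes> Vp i e = Vp i (e - 1)"
      using i False by (cases "e = 0") (simp_all add: Vp_def pow_Suc_left del: nat_pow_Suc)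
    then show ?thesis using closure by simp
  next
    case True
    then have m: "nat e = Suc (nat (e - 1))" by simp
    have "Vp i e = g i Psi \<otimes> Vp i (e - 1)"
      using i True m by (simp add: Vp_def pow_Suc_left del: nat_pow_Suc)
    then show ?thesis using PsidPsi closure by simp
  qed
qed

text \<open>\<open>Psi\<close> and \<open>Psid\<close> pass the power of \<open>Om\<close> at the
  cost of a scalar and then meet \<open>Vp\<close>.\<close>

lemma g_Mp_lspan:
  assumes i: "i < n" shows "g i a \<otimes> Mp i p \<in> lspan (range (Mp i))"
proof -
  note B = range_Mp_closed[OF i]
  have *: "x \<otimes> Mp i p \<in> lspan (range (Mp i))"
    if x: "x \<in> carrier A" "c \<noteq> 0" "x \<otimes> g i Om = sc c \<otimes> (g i Om \<otimes> x)"
      "x \<otimes> Vp i (snd p) \<in> lspan (range (Mp i))" for x c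
  proof -
    obtain c' where c': "x \<otimes> Zp i (fst p) = sc c' \<otimes> (Zp i (fst p) \<otimes> x)"
      using q_commute_Zp[OF i x(1,2,3)] by blast
    have "x \<otimes> Mp i p = sc c' \<otimes> (Zp i (fst p) \<otimes> (x \<otimes> Vp i (snd p)))"
      using i x(1) c' by (simp add: Mp_def m_assoc[symmetric])
    then show ?thesis using lspan_scale[OF B] Om_pow_lspan[OF i] x(4) by simp
  qed
  have "Mp i p \<in> lspan (range (Mp i))" using lspan_base[OF B] by blast
  then show ?thesis
    using Om_lspan[OF i] *[of "g i Psi" q] *[of "g i Psid" "inverse q"] Psi_Vp_lspan[OF i]
      Psi_Om[OF i] Psid_Om[OF i] q_nonzero i
    by (cases a) auto
qed

lemma commute_Np:
  assumes "m \<le> j" "j < n" shows "g j a \<otimes> Np m k = Np m k \<otimes> g j a"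
  using assms
proof (induction m)
  case (Suc m)
  then have m: "m < n" "m \<noteq> j" by simp_all
  have pow: "g j a \<otimes> g m b [^] (r::nat) = g m b [^] r \<otimes> g j a" for b r
    using q_commute_pow[of "g j a" "g m b" 1 r] m Suc.prems g_commute[of j m a b]
    by (simp add: sc_one)
  then have Z: "g j a \<otimes> Zp m b = Zp m b \<otimes> g j a" and V: "g j a \<otimes> Vp m b = Vp m b \<otimes> g j a" for b
    by (simp_all add: Zp_def Vp_def)
  have M: "g j a \<otimes> Mp m p = Mp m p \<otimes> g j a" for p
  proof -
    have "g j a \<otimes> Mp m p = Zp m (fst p) \<otimes> (g j a \<otimes> Vp m (snd p))"
      using Suc.prems m by (simp add: Mp_def Z flip: m_assoc)
    then show ?thesis using Suc.prems m by (simp add: V Mp_def m_assoc)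
  qed
  have "g j a \<otimes> Np (Suc m) k = Np m k \<otimes> (g j a \<otimes> Mp m (k m))"
    using Suc m by (simp flip: m_assoc)
  then show ?case using Suc.prems m by (simp add: M m_assoc)
qed simp

lemma Np_Suc_upd: "Np m k \<otimes> Mp m p = Np (Suc m) (k(m := p))"
  using Np_cong[of m k "k(m := p)"] by simp

text \<open>A generator of the last factor passes the earlier factors, with which it commutes. Any
  other generator is absorbed by the induction hypothesis before the last factor is
  attached.\<close>

lemma g_Np_lspan:
  assumes "m \<le> n" "j < m" "k \<in> Ks m"
  shows "g j a \<otimes> Np m k \<in> lspan (Np m ` Ks m)"
  using assms
proof (induction m arbitrary: k)
  case (Suc m)
  \<comment> \<open>The induction hypothesis speaks of \<open>Ks m\<close>, so entry
    \<open>m\<close> is reset; \<open>Np m\<close> does not see that entry.\<close>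
  let ?k = "k(m := (0, 0))"
  have k: "?k \<in> Ks m" using Suc.prems by (auto simp: Ks_def le_Suc_eq)
  have Npk: "Np m k = Np m ?k" by (rule Np_cong) simp
  have upd: "k'(m := p) \<in> Ks (Suc m)" if "k' \<in> Ks m" for k' p
    using that by (auto simp: Ks_def)
  have B: "Np m ` Ks m \<subseteq> carrier A" "Np (Suc m) ` Ks (Suc m) \<subseteq> carrier A"
    using Suc.prems by (auto simp del: Np.simps)
  have base: "Np m k' \<otimes> Mp m p \<in> lspan (Np (Suc m) ` Ks (Suc m))" if "k' \<in> Ks m" for k' p
    unfolding Np_Suc_upd using upd[OF that] by (intro lspan_base[OF B(2)]) blast
  then have base': "b \<otimes> Mp m p \<in> lspan (Np (Suc m) ` Ks (Suc m))" if "b \<in> Np m ` Ks m" for b p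
    using that by blast
  show ?case
  proof (cases "j = m")
    case True
    have m: "m < n" using Suc.prems by simp
    have "g j a \<otimes> Np (Suc m) k = Np m ?k \<otimes> (g m a \<otimes> Mp m (k m))"
      using Suc.prems m True commute_Np[of m m a k] by (simp add: Npk flip: m_assoc)
    moreover have "Np m ?k \<otimes> (g m a \<otimes> Mp m (k m)) \<in> lspan (Np (Suc m) ` Ks (Suc m))"
    proof (rule lspan_mult_left[OF range_Mp_closed B(2)])
      show "Np m ?k \<otimes> b \<in> lspan (Np (Suc m) ` Ks (Suc m))" if "b \<in> range (Mp m)" for b
        using that base[OF k] by blast
    qed (use m g_Mp_lspan in simp_all)
    ultimately show ?thesis by simp
  next
    case False
    then have "g j a \<otimes> Np m ?k \<in> lspan (Np m ` Ks m)" using Suc k by simp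
    then have "g j a \<otimes> Np m ?k \<otimes> Mp m (k m) \<in> lspan (Np (Suc m) ` Ks (Suc m))"
      using base Suc.prems by (intro lspan_mult_right[OF B(1,2) _ base']) simp_all
    then show ?thesis using Suc.prems by (simp add: Npk m_assoc)
  qed
qed simp

text \<open>The span contains the scalars and is closed under addition and under left multiplication
  by generators, so \<open>gen_induct\<close> applies.\<close>

lemma carrier_lspan:
  assumes "x \<in> carrier A" shows "x \<in> lspan (Np n ` Ks n)"
  using assms
proof (rule gen_induct)
  have B: "Np n ` Ks n \<subseteq> carrier A" by auto
  have "Np m (\<lambda>i. (0, 0)) = \<one>" for m
    by (induction m) (simp_all add: Mp_def Zp_def Vp_def)
  moreover have "(\<lambda>i. (0, 0)) \<in> Ks n" by (simp add: Ks_def)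
  ultimately have "\<one> \<in> Np n ` Ks n" by (metis imageI)
  then have "sc c \<otimes> \<one> \<in> lspan (Np n ` Ks n)" for c
    using lspan_scale[OF B] lspan_base[OF B] by blast
  then show "sc c \<in> lspan (Np n ` Ks n)" for c by simp
  show "g i a \<otimes> x \<in> lspan (Np n ` Ks n)" if "x \<in> lspan (Np n ` Ks n)" "i < n" for x i a
  proof (rule lspan_mult_left[OF B B _ _ that(1)])
    show "g i a \<in> carrier A" using that(2) by simp
    show "g i a \<otimes> b \<in> lspan (Np n ` Ks n)" if "b \<in> Np n ` Ks n" for b
      using that \<open>i < n\<close> g_Np_lspan by blast
  qed
  show "x \<oplus> y \<in> lspan (Np n ` Ks n)" if "x \<in> lspan (Np n ` Ks n)" "y \<in> lspan (Np n ` Ks n)" for x y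
    using that by (rule lspan_add[OF B])
qed

lemma normal_form:
  assumes "x \<in> carrier A"
  obtains K c where "finite K" "K \<subseteq> Ks n" "x = (\<Oplus>k\<in>K. sc (c k) \<otimes> Np n k)"
proof -
  have "\<exists>K c. finite K \<and> K \<subseteq> Ks n \<and> x = (\<Oplus>k\<in>K. sc (c k) \<otimes> Np n k)"
    using carrier_lspan[OF assms]
  proof induction
    case zero
    show ?case by (intro exI[of _ "{}"]) simp
  next
    case (add b x c0)
    then obtain K c k0 where K: "finite K" "K \<subseteq> Ks n" "x = (\<Oplus>k\<in>K. sc (c k) \<otimes> Np n k)"
      and k0: "k0 \<in> Ks n" "b = Np n k0" by blast
    \<comment> \<open>The monomial of \<open>k0\<close> may already occur; its old coefficient is
      then merged with the new one.\<close>
    define c' where "c' = c(k0 := c0 + (if k0 \<in> K then c k0 else 0))"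
    let ?r = "\<Oplus>k\<in>K - {k0}. sc (c k) \<otimes> Np n k"
    have r: "?r \<in> carrier A" by (rule finsum_closed) auto
    have "x = sc (if k0 \<in> K then c k0 else 0) \<otimes> b \<oplus> ?r"
    proof (cases "k0 \<in> K")
      case True
      then have "x = (\<Oplus>k\<in>insert k0 (K - {k0}). sc (c k) \<otimes> Np n k)"
        using K(3) by (simp add: insert_absorb)
      also have "\<dots> = sc (c k0) \<otimes> Np n k0 \<oplus> ?r" using K(1) by (subst finsum_insert) auto
      finally show ?thesis using True k0 by simp
    next
      case False
      then show ?thesis using K k0 r by (simp add: sc_zero)
    qed
    then have "sc c0 \<otimes> b \<oplus> x = sc (c' k0) \<otimes> b \<oplus> ?r"
      using k0 r by (simp add: c'_def sc_add l_distr a_assoc)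
    also have "?r = (\<Oplus>k\<in>K - {k0}. sc (c' k) \<otimes> Np n k)"
      by (intro finsum_cong') (auto simp: c'_def)
    also have "sc (c' k0) \<otimes> b \<oplus> \<dots> = (\<Oplus>k\<in>insert k0 (K - {k0}). sc (c' k) \<otimes> Np n k)"
      using K(1) k0 by (subst finsum_insert) auto
    finally show ?case using K k0 by (intro exI[of _ "insert k0 (K - {k0})"] exI[of _ c']) auto
  qed
  then show thesis using that by blast
qed

end

section \<open>Linear independence by leading exponents\<close>

lemma dot_sum_left: "dot (\<Sum>i\<in>I. f i) b = (\<Sum>i\<in>I. dot (f i) b)"
  by (induction I rule: infinite_finite_induct) (simp_all add: dot_add_left)

lemma dot_sum_right: "dot d (\<Sum>i\<in>I. f i) = (\<Sum>i\<in>I. dot d (f i))"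
  by (induction I rule: infinite_finite_induct) (simp_all add: dot_add_right)

lemma dot_cmul_right: "dot d (frag_cmul c b) = c * dot d b"
  by (simp add: dot_def sum_distrib_left mult_ac)

lemma dot_cmul_left: "dot (frag_cmul c d) b = c * dot d b"
proof -
  have "keys (frag_cmul c d) \<subseteq> keys d" by (rule keys_cmul)
  then show ?thesis
    by (simp add: dot_superset[of "keys d"] sum_distrib_left mult_ac)
qed

lemma frag_cmul_minus_minus: "frag_cmul (- c) (- d) = frag_cmul c d"
  by (rule poly_mapping_eqI) simp

context quantum_torus
begin

text \<open>Among the summands with nonzero coefficient, take the one with the largest leading
  exponent. No other such summand contains that exponent, so it could not cancel.\<close>

lemma coefficients_zero_if_distinct_max_keys:
  assumes "finite K" and nz: "\<And>k. k \<in> K \<Longrightarrow> F k \<noteq> 0"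
    and inj: "inj_on (\<lambda>k. Max (keys (F k))) K"
    and sum: "(\<Sum>k\<in>K. single 0 (c k) \<star> F k) = 0" and "k \<in> K"
  shows "c k = 0"
proof (rule ccontr)
  assume "c k \<noteq> 0"
  define K' where "K' = {k \<in> K. c k \<noteq> 0}"
  let ?l = "\<lambda>k. Max (keys (F k))"
  have K': "finite K'" "K' \<noteq> {}" using assms \<open>c k \<noteq> 0\<close> by (auto simp: K'_def)
  then have "Max (?l ` K') \<in> ?l ` K'" by (intro Max_in) auto
  then obtain k0 where k0: "k0 \<in> K'" "?l k0 = Max (?l ` K')" by auto
  have zero: "c k' * lookup (F k') (?l k0) = 0" if "k' \<in> K - {k0}" for k'
  proof (cases "k' \<in> K'")
    case True
    then have "?l k' \<le> ?l k0" using k0 K' by simp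
    moreover have "?l k' \<noteq> ?l k0" using inj that k0 by (auto simp: inj_on_def K'_def)
    ultimately have "?l k0 \<notin> keys (F k')" by (metis Max_ge finite_keys order_antisym)
    then show ?thesis by (simp add: in_keys_iff)
  qed (use that in \<open>auto simp: K'_def\<close>)
  have "0 = (\<Sum>k'\<in>K. c k' * lookup (F k') (?l k0))"
    using arg_cong[OF sum, of "\<lambda>P. lookup P (?l k0)"] by (simp add: lookup_sum)
  also have "\<dots> = c k0 * lookup (F k0) (?l k0) + (\<Sum>k'\<in>K - {k0}. c k' * lookup (F k') (?l k0))"
    using k0 assms(1) by (intro sum.remove) (auto simp: K'_def)
  also have "(\<Sum>k'\<in>K - {k0}. c k' * lookup (F k') (?l k0)) = 0"
    using zero by (intro sum.neutral ballI)
  finally have "lookup (F k0) (?l k0) = 0" using k0 by (simp add: K'_def)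
  moreover have "?l k0 \<in> keys (F k0)" using k0 nz by (intro Max_in) (auto simp: K'_def)
  ultimately show False by (simp add: in_keys_iff)
qed

end

section \<open>A criterion for injectivity of homomorphisms into the torus\<close>

locale gwa_algebra_torus = gwa_algebra A q t n sc g + gwa_torus q t n
  for A (structure) and q :: "'k::field" and t n :: nat and sc g
begin

definition scalar_hom :: "('a \<Rightarrow> 'k torus) \<Rightarrow> bool" where
  "scalar_hom \<Phi> \<longleftrightarrow> \<Phi> \<in> ring_hom A (torus_ring q) \<and> (\<forall>c. \<Phi> (sc c) = single 0 c)"

context
  fixes \<Phi> assumes hom: "scalar_hom \<Phi>"
begin

lemma hom_simps:
  "x \<in> carrier A \<Longrightarrow> y \<in> carrier A \<Longrightarrow> \<Phi> (x \<otimes> y) = \<Phi> x \<star> \<Phi> y"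
  "x \<in> carrier A \<Longrightarrow> y \<in> carrier A \<Longrightarrow> \<Phi> (x \<oplus> y) = \<Phi> x + \<Phi> y"
  "\<Phi> \<one> = 1" "\<Phi> (sc c) = single 0 c"
  using hom ring_hom_mult[of \<Phi> A "torus_ring q"] ring_hom_add[of \<Phi> A "torus_ring q"]
    ring_hom_one[of \<Phi> A "torus_ring q"]
  by (simp_all add: scalar_hom_def)

lemma hom_zero: "\<Phi> \<zero> = 0"
  using hom_simps(4)[of 0] by (simp add: sc_zero)

lemma hom_minus:
  assumes "x \<in> carrier A" "y \<in> carrier A" shows "\<Phi> (x \<ominus> y) = \<Phi> x - \<Phi> y"
proof -
  have "x = (x \<ominus> y) \<oplus> y" using assms by (simp add: minus_eq a_assoc l_neg)
  then have "\<Phi> x = \<Phi> (x \<ominus> y) + \<Phi> y" using assms hom_simps(2)[of "x \<ominus> y" y] by simp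
  then show ?thesis by simp
qed

lemma hom_pow:
  assumes "x \<in> carrier A" shows "\<Phi> (x [^] (k::nat)) = (mul (\<Phi> x) ^^ k) 1"
proof (induction k)
  case (Suc k)
  then show ?case
    using assms by (simp only: nat_pow_Suc2) (simp add: hom_simps)
qed (simp add: hom_simps)

lemma hom_finsum:
  assumes "finite K" "\<And>k. k \<in> K \<Longrightarrow> F k \<in> carrier A"
  shows "\<Phi> (\<Oplus>k\<in>K. F k) = (\<Sum>k\<in>K. \<Phi> (F k))"
  using assms
  by (induction K rule: finite_induct) (simp_all add: hom_zero hom_simps Pi_def)

lemma hom_pow_max_key:
  assumes "x \<in> carrier A" "\<Phi> x \<noteq> 0"
  shows "\<Phi> (x [^] (m::nat)) \<noteq> 0
    \<and> fst (Max (keys (\<Phi> (x [^] m)))) = frag_cmul (int m) (fst (Max (keys (\<Phi> x))))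
    \<and> snd (Max (keys (\<Phi> (x [^] m)))) = frag_cmul (int m) (snd (Max (keys (\<Phi> x))))"
proof (induction m)
  case 0
  have "Max (keys (1 :: 'k torus)) = 0" by simp
  then show ?case by (simp add: hom_simps)
next
  case (Suc m)
  then show ?case
    using assms mul_max_key[of "\<Phi> (x [^] m)" "\<Phi> x"]
    by (simp add: hom_simps frag_cmul_distrib add.commute)
qed

text \<open>The leading exponent of the image determines a normal monomial: its
  \<open>x\<close>-part is a combination of the \<open>d i\<close>, and pairing with \<alpha>
  recovers the powers of \<open>Psi\<close> and \<open>Psid\<close>; then pairing the \<Omega>-part
  with \<open>d\<close> recovers the powers of \<open>Om\<close>. The criterion serves both the
  embedding \<open>tensor_rep\<close> and its composite with an endomorphism.\<close>

lemma hom_inj_on: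
  assumes Om: "\<And>i. i < n \<Longrightarrow> \<exists>C. C \<noteq> 0 \<and> \<Phi> (g i Om) = single (\<alpha> i, 0) C"
    and Omi: "\<And>i. i < n \<Longrightarrow> \<exists>C. C \<noteq> 0 \<and> \<Phi> (g i Omi) = single (- \<alpha> i, 0) C"
    and Psi: "\<And>i. i < n \<Longrightarrow> \<Phi> (g i Psi) \<noteq> 0 \<and> (\<forall>u\<in>keys (\<Phi> (g i Psi)). snd u = d i)"
    and Psid: "\<And>i. i < n \<Longrightarrow> \<Phi> (g i Psid) \<noteq> 0 \<and> (\<forall>u\<in>keys (\<Phi> (g i Psid)). snd u = - d i)"
    and dual: "\<And>i j. i < n \<Longrightarrow> j < n \<Longrightarrow> dot (d i) (\<alpha> j) = (if i = j then 1 else 0)"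
  shows "inj_on \<Phi> (carrier A)"
proof -
  let ?l = "\<lambda>x. Max (keys (\<Phi> x))"
  have Max_in': "Max (keys P) \<in> keys P" if "P \<noteq> 0" for P :: "'k torus"
    using that by (intro Max_in) auto
  have Z: "\<Phi> (Zp i b) \<noteq> 0 \<and> ?l (Zp i b) = (frag_cmul b (\<alpha> i), 0)" if i: "i < n" for i b
  proof (cases "b \<ge> 0")
    case True
    obtain C where "C \<noteq> 0" "\<Phi> (g i Om) = single (\<alpha> i, 0) C" using Om[OF i] by blast
    then show ?thesis
      using hom_pow_max_key[of "g i Om" "nat b"] i True by (simp add: Zp_def prod_eq_iff)
  next
    case False
    obtain C where "C \<noteq> 0" "\<Phi> (g i Omi) = single (- \<alpha> i, 0) C" using Omi[OF i] by blast
    then show ?thesis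
      using hom_pow_max_key[of "g i Omi" "nat (- b)"] i False
      by (simp add: Zp_def prod_eq_iff frag_cmul_minus_minus)
  qed
  have V: "\<Phi> (Vp i e) \<noteq> 0 \<and> snd (?l (Vp i e)) = frag_cmul e (d i)" if i: "i < n" for i e
  proof (cases "e \<ge> 0")
    case True
    have "snd (?l (g i Psi)) = d i" using Psi[OF i] Max_in' by blast
    then show ?thesis
      using hom_pow_max_key[of "g i Psi" "nat e"] Psi[OF i] i True by (simp add: Vp_def)
  next
    case False
    have "snd (?l (g i Psid)) = - d i" using Psid[OF i] Max_in' by blast
    then show ?thesis
      using hom_pow_max_key[of "g i Psid" "nat (- e)"] Psid[OF i] i False
      by (simp add: Vp_def frag_cmul_minus_minus)
  qed
  have N: "\<Phi> (Np m k) \<noteq> 0 \<and>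
      ?l (Np m k) = (\<Sum>i<m. (frag_cmul (fst (k i)) (\<alpha> i), 0) + ?l (Vp i (snd (k i))))"
    if "m \<le> n" for m k
    using that
  proof (induction m)
    case 0
    have "Max (keys (1 :: 'k torus)) = 0" by simp
    then show ?case by (simp add: hom_simps)
  next
    case (Suc m)
    then have m: "m < n" by simp
    have "\<Phi> (Mp m (k m)) \<noteq> 0 \<and>
        ?l (Mp m (k m)) = (frag_cmul (fst (k m)) (\<alpha> m), 0) + ?l (Vp m (snd (k m)))"
      using Z[OF m] V[OF m] mul_max_key m by (simp add: Mp_def hom_simps)
    then show ?case
      using Suc m mul_max_key[of "\<Phi> (Np m k)" "\<Phi> (Mp m (k m))"] by (simp add: hom_simps)
  qed
  have inj: "inj_on (\<lambda>k. ?l (Np n k)) (Ks n)"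
  proof (rule inj_onI)
    fix k k' assume k: "k \<in> Ks n" "k' \<in> Ks n" and eq: "?l (Np n k) = ?l (Np n k')"
    have delta: "(\<Sum>i<n. f i * (if i = j then 1 else 0)) = f j" "(\<Sum>i<n. f i * (if j = i then 1 else 0)) = f j"
      if "j < n" for f :: "nat \<Rightarrow> int" and j
      using that by (simp_all add: if_distrib[of "\<lambda>x. _ * x"] sum.delta cong: if_cong)
    have snd_l: "dot (snd (?l (Np n k))) (\<alpha> j) = snd (k j)" if "j < n" for k j
    proof -
      have "dot (snd (?l (Np n k))) (\<alpha> j) = (\<Sum>i<n. snd (k i) * dot (d i) (\<alpha> j))"
        using N[of n k] V by (simp add: snd_sum dot_sum_left dot_cmul_left)
      also have "\<dots> = (\<Sum>i<n. snd (k i) * (if i = j then 1 else 0))"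
        using dual that by (intro sum.cong) simp_all
      finally show ?thesis using delta that by simp
    qed
    have snd_eq: "snd (k j) = snd (k' j)" if "j < n" for j
      using snd_l[OF that, of k] snd_l[OF that, of k'] eq by simp
    \<comment> \<open>The \<Omega>-parts of the leading exponents for \<open>Vp\<close> are unknown,
      but they depend only on the second entries, already known to agree, and therefore
      cancel.\<close>
    have "(\<Sum>i<n. frag_cmul (fst (k i)) (\<alpha> i)) + (\<Sum>i<n. fst (?l (Vp i (snd (k i)))))
        = (\<Sum>i<n. frag_cmul (fst (k' i)) (\<alpha> i)) + (\<Sum>i<n. fst (?l (Vp i (snd (k' i)))))"
      using arg_cong[OF eq, of fst] N[of n k] N[of n k'] by (simp add: fst_sum sum.distrib)
    moreover have "(\<Sum>i<n. fst (?l (Vp i (snd (k i))))) = (\<Sum>i<n. fst (?l (Vp i (snd (k' i)))))"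
      using snd_eq by (intro sum.cong) simp_all
    ultimately have fsts: "(\<Sum>i<n. frag_cmul (fst (k i)) (\<alpha> i)) = (\<Sum>i<n. frag_cmul (fst (k' i)) (\<alpha> i))"
      by simp
    have fst_l: "dot (d j) (\<Sum>i<n. frag_cmul (fst (k i)) (\<alpha> i)) = fst (k j)" if "j < n" for k :: "nat \<Rightarrow> int \<times> int" and j
    proof -
      have "dot (d j) (\<Sum>i<n. frag_cmul (fst (k i)) (\<alpha> i)) = (\<Sum>i<n. fst (k i) * (if j = i then 1 else 0))"
        unfolding dot_sum_right dot_cmul_right using dual that by (intro sum.cong) simp_all
      then show ?thesis using delta that by simp
    qed
    show "k = k'"
    proof
      fix j show "k j = k' j"
      proof (cases "j < n")
        case True
        then have "fst (k j) = fst (k' j)" using fst_l[of j k] fst_l[of j k'] fsts by simp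
        then show ?thesis using snd_eq[OF True] by (simp add: prod_eq_iff)
      qed (use k in \<open>simp add: Ks_def\<close>)
    qed
  qed
  have kernel: "x = \<zero>" if x: "x \<in> carrier A" "\<Phi> x = 0" for x
  proof -
    obtain K c where K: "finite K" "K \<subseteq> Ks n" "x = (\<Oplus>k\<in>K. sc (c k) \<otimes> Np n k)"
      by (rule normal_form[OF x(1)])
    have "(\<Sum>k\<in>K. single 0 (c k) \<star> \<Phi> (Np n k)) = 0"
      using x(2) K(1) by (simp add: K(3) hom_finsum hom_simps)
    then have "c k = 0" if "k \<in> K" for k
      using coefficients_zero_if_distinct_max_keys[OF K(1), of "\<lambda>k. \<Phi> (Np n k)" c k]
        N inj_on_subset[OF inj K(2)] that by simp
    then have "x = (\<Oplus>k\<in>K. \<zero>)" unfolding K(3) by (intro finsum_cong') (auto simp: sc_zero)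
    then show ?thesis by simp
  qed
  show ?thesis
  proof (rule inj_onI)
    fix x y assume xy: "x \<in> carrier A" "y \<in> carrier A" "\<Phi> x = \<Phi> y"
    then have "x \<ominus> y = \<zero>" by (intro kernel) (simp_all add: hom_minus)
    moreover have "x = (x \<ominus> y) \<oplus> y" using xy(1,2) by (simp add: minus_eq a_assoc l_neg)
    ultimately show "x = y" using xy(2) by simp
  qed
qed

end

end

section \<open>Endomorphisms\<close>

context gwa_torus
begin

abbreviation "FA \<equiv> free_alg (tgens n) :: ((nat \<times> hgen) list \<Rightarrow> 'k) ring"
abbreviation "TI \<equiv> tensor_ideal q t n"
abbreviation "TH \<equiv> tensorH q t n"

definition proj :: "((nat \<times> hgen) list \<Rightarrow> 'k) \<Rightarrow> ((nat \<times> hgen) list \<Rightarrow> 'k) set" where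
  "proj f = TI +>\<^bsub>FA\<^esub> f"

lemma ideal_TI: "ideal TI FA"
  unfolding tensor_ideal_def
  by (rule ring.genideal_ideal[OF ring_free_alg]) (use tensor_rels_subset in simp)

lemma TH_ring: "ring TH"
  unfolding tensorH_def by (rule ideal.quotient_is_ring[OF ideal_TI])

lemma proj_hom: "proj \<in> ring_hom FA TH"
  unfolding tensorH_def proj_def[abs_def] by (rule ideal.rcos_ring_hom[OF ideal_TI])

lemma proj_simps:
  "f \<in> fa_carrier (tgens n) \<Longrightarrow> proj f \<in> carrier TH"
  "f \<in> fa_carrier (tgens n) \<Longrightarrow> h \<in> fa_carrier (tgens n) \<Longrightarrow> proj (fmul f h) = proj f \<otimes>\<^bsub>TH\<^esub> proj h"
  "f \<in> fa_carrier (tgens n) \<Longrightarrow> h \<in> fa_carrier (tgens n) \<Longrightarrow> proj (fadd f h) = proj f \<oplus>\<^bsub>TH\<^esub> proj h"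
  "proj (fconst 1) = \<one>\<^bsub>TH\<^esub>"
  using ring_hom_closed[OF proj_hom] ring_hom_mult[OF proj_hom] ring_hom_add[OF proj_hom]
    ring_hom_one[OF proj_hom]
  by simp_all

lemma carrier_TH: "carrier TH = proj ` fa_carrier (tgens n)"
  by (auto simp: tensorH_def FactRing_def A_RCOSETS_def' proj_def)

lemma proj_fsmul:
  "f \<in> fa_carrier (tgens n) \<Longrightarrow> proj (fsmul c f) = proj (fconst c) \<otimes>\<^bsub>TH\<^esub> proj f"
  by (simp add: fsmul_eq proj_simps)

lemma proj_fsub:
  assumes "f \<in> fa_carrier (tgens n)" "h \<in> fa_carrier (tgens n)"
  shows "proj (fsub f h) = proj f \<ominus>\<^bsub>TH\<^esub> proj h"
proof -
  interpret ring TH by (rule TH_ring)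
  have "f = fadd (fsub f h) h" by (simp add: fsub_def fadd_def)
  then have "proj f = proj (fsub f h) \<oplus>\<^bsub>TH\<^esub> proj h"
    using assms proj_simps(3)[of "fsub f h" h] by simp
  then show ?thesis
    using assms by (simp add: proj_simps minus_eq a_assoc r_neg)
qed

lemma proj_fpow:
  assumes "f \<in> fa_carrier (tgens n)" shows "proj (fpow f k) = proj f [^]\<^bsub>TH\<^esub> (k::nat)"
proof -
  interpret ring TH by (rule TH_ring)
  show ?thesis
  proof (induction k)
    case (Suc k)
    then show ?case
      using assms by (simp only: nat_pow_Suc2 proj_simps(1)) (simp add: fpow_Suc proj_simps)
  qed (simp add: fpow_0 proj_simps)
qed

lemma proj_relation:
  assumes "fsub f h \<in> tensor_rels q t n" "f \<in> fa_carrier (tgens n)" "h \<in> fa_carrier (tgens n)"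
  shows "proj f = proj h"
proof -
  interpret ring TH by (rule TH_ring)
  have "fsub f h \<in> TI"
    unfolding tensor_ideal_def
    using ring.genideal_self[OF ring_free_alg, of "tensor_rels q t n" "tgens n"] tensor_rels_subset assms(1)
    by auto
  then have "proj (fsub f h) = \<zero>\<^bsub>TH\<^esub>"
    using ring.a_rcos_zero[OF ring_free_alg ideal_TI] by (simp add: proj_def tensorH_def FactRing_def)
  moreover have "f = fadd (fsub f h) h" by (simp add: fsub_def fadd_def)
  ultimately show ?thesis
    using assms proj_simps(3)[of "fsub f h" h] by (simp add: proj_simps)
qed

lemma tensor_gwa_algebra:
  "gwa_algebra TH q t n (tensorH_scalar q t n) (\<lambda>i a. proj (fgen (i, a)))"
proof -
  interpret TH: ring TH by (rule TH_ring)
  have sc: "tensorH_scalar q t n c = proj (fconst c)" for c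
    by (simp add: tensorH_scalar_def proj_def)
  have gen: "fgen (i, a) \<in> fa_carrier (tgens n)" if "i < n" for i a
    using that by (simp add: tgens_def)
  have add: "fconst (c + c') = fadd (fconst c) (fconst c')" for c c' :: 'k
    by (auto simp: fconst_def fadd_def)
  have mult: "fconst (c * c') = fmul (fconst c) (fconst c')" for c c' :: 'k
    by (simp add: fconst_eq_fmon fmul_fmon)
  have rel: "H_rels q t (\<lambda>g. (i, g)) \<subseteq> tensor_rels q t n" if "i < n" for i
    using that by (auto simp: tensor_rels_def)
  note simps = gen proj_simps proj_fsmul proj_fsub proj_fpow sc
  show ?thesis
  proof
    show "q \<noteq> 0" by (rule q_nz)
    show "tensorH_scalar q t n c \<in> carrier TH" for c by (simp add: simps)
    show "tensorH_scalar q t n (c + c') = tensorH_scalar q t n c \<oplus>\<^bsub>TH\<^esub> tensorH_scalar q t n c'" for c c'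
      by (simp add: simps add)
    show "tensorH_scalar q t n (c * c') = tensorH_scalar q t n c \<otimes>\<^bsub>TH\<^esub> tensorH_scalar q t n c'" for c c'
      by (simp add: simps mult)
    show "tensorH_scalar q t n 1 = \<one>\<^bsub>TH\<^esub>" by (simp add: simps)
    show "x \<otimes>\<^bsub>TH\<^esub> tensorH_scalar q t n c = tensorH_scalar q t n c \<otimes>\<^bsub>TH\<^esub> x" if "x \<in> carrier TH" for x c
      using that by (auto simp: carrier_TH sc proj_simps(2)[symmetric] fmul_fconst_right fsmul_eq)
    show "proj (fgen (i, a)) \<in> carrier TH" if "i < n" for i a using that by (simp add: simps)
    fix i assume i: "i < n"
    have R: "proj f = proj h"
      if "fsub f h \<in> H_rels q t (\<lambda>g. (i, g))" "f \<in> fa_carrier (tgens n)" "h \<in> fa_carrier (tgens n)" for f h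
      using that rel[OF i] by (intro proj_relation) auto
    show "proj (fgen (i, Om)) \<otimes>\<^bsub>TH\<^esub> proj (fgen (i, Omi)) = \<one>\<^bsub>TH\<^esub>"
      using R[of "fmul (fgen (i, Om)) (fgen (i, Omi))" "fconst 1"] i
      by (simp add: simps H_rels_def Let_def)
    show "proj (fgen (i, Omi)) \<otimes>\<^bsub>TH\<^esub> proj (fgen (i, Om)) = \<one>\<^bsub>TH\<^esub>"
      using R[of "fmul (fgen (i, Omi)) (fgen (i, Om))" "fconst 1"] i
      by (simp add: simps H_rels_def Let_def)
    show "proj (fgen (i, Psi)) \<otimes>\<^bsub>TH\<^esub> proj (fgen (i, Om)) =
        tensorH_scalar q t n q \<otimes>\<^bsub>TH\<^esub> (proj (fgen (i, Om)) \<otimes>\<^bsub>TH\<^esub> proj (fgen (i, Psi)))"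
      using R[of "fmul (fgen (i, Psi)) (fgen (i, Om))" "fsmul q (fmul (fgen (i, Om)) (fgen (i, Psi)))"] i
      by (simp add: simps H_rels_def Let_def)
    show "proj (fgen (i, Psid)) \<otimes>\<^bsub>TH\<^esub> proj (fgen (i, Om)) =
        tensorH_scalar q t n (inverse q) \<otimes>\<^bsub>TH\<^esub> (proj (fgen (i, Om)) \<otimes>\<^bsub>TH\<^esub> proj (fgen (i, Psid)))"
      using R[of "fmul (fgen (i, Psid)) (fgen (i, Om))"
          "fsmul (inverse q) (fmul (fgen (i, Om)) (fgen (i, Psid)))"] i
      by (simp add: simps H_rels_def Let_def)
    show "proj (fgen (i, Psi)) \<otimes>\<^bsub>TH\<^esub> proj (fgen (i, Psid)) =
        tensorH_scalar q t n (inverse (q ^ t - inverse q ^ t)) \<otimes>\<^bsub>TH\<^esub>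
        (tensorH_scalar q t n (q ^ t) \<otimes>\<^bsub>TH\<^esub> proj (fgen (i, Om)) [^]\<^bsub>TH\<^esub> t \<ominus>\<^bsub>TH\<^esub>
         tensorH_scalar q t n (inverse q ^ t) \<otimes>\<^bsub>TH\<^esub> proj (fgen (i, Omi)) [^]\<^bsub>TH\<^esub> t)"
      using R[of "fmul (fgen (i, Psi)) (fgen (i, Psid))" "fsmul (inverse (q ^ t - inverse q ^ t))
          (fsub (fsmul (q ^ t) (fpow (fgen (i, Om)) t)) (fsmul (inverse q ^ t) (fpow (fgen (i, Omi)) t)))"] i
      by (simp add: simps H_rels_def Let_def)
    show "proj (fgen (i, Psid)) \<otimes>\<^bsub>TH\<^esub> proj (fgen (i, Psi)) =
        tensorH_scalar q t n (inverse (q ^ t - inverse q ^ t)) \<otimes>\<^bsub>TH\<^esub>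
        (proj (fgen (i, Om)) [^]\<^bsub>TH\<^esub> t \<ominus>\<^bsub>TH\<^esub> proj (fgen (i, Omi)) [^]\<^bsub>TH\<^esub> t)"
      using R[of "fmul (fgen (i, Psid)) (fgen (i, Psi))" "fsmul (inverse (q ^ t - inverse q ^ t))
          (fsub (fpow (fgen (i, Om)) t) (fpow (fgen (i, Omi)) t))"] i
      by (simp add: simps H_rels_def Let_def)
    fix j a b assume j: "j < n" "i \<noteq> j"
    have "fsub (fmul (fgen (i, a)) (fgen (j, b))) (fmul (fgen (j, b)) (fgen (i, a))) \<in> tensor_rels q t n"
      using i j unfolding tensor_rels_def by blast
    then show "proj (fgen (i, a)) \<otimes>\<^bsub>TH\<^esub> proj (fgen (j, b)) = proj (fgen (j, b)) \<otimes>\<^bsub>TH\<^esub> proj (fgen (i, a))"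
      using proj_relation i j by (simp add: gen flip: proj_simps(2))
  next
    fix x and S :: "((nat \<times> hgen) list \<Rightarrow> 'k) set \<Rightarrow> bool"
    assume x: "x \<in> carrier TH" and S: "\<And>c. S (tensorH_scalar q t n c)"
      "\<And>x i a. x \<in> carrier TH \<Longrightarrow> S x \<Longrightarrow> i < n \<Longrightarrow> S (proj (fgen (i, a)) \<otimes>\<^bsub>TH\<^esub> x)"
      "\<And>x y. x \<in> carrier TH \<Longrightarrow> S x \<Longrightarrow> y \<in> carrier TH \<Longrightarrow> S y \<Longrightarrow> S (x \<oplus>\<^bsub>TH\<^esub> y)"
    have "S (proj f)" if "f \<in> fa_carrier (tgens n)" for f
      using that
    proof (induction rule: fa_induct_left)
      case (const c)
      then show ?case using S(1)[of c] by (simp add: sc)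
    next
      case (gen f x)
      then show ?case
        using S(2)[of "proj f" "fst x" "snd x"] by (auto simp: proj_simps tgens_def)
    next
      case (add f h)
      then show ?case using S(3) by (simp add: proj_simps)
    qed
    then show "S x" using x by (auto simp: carrier_TH)
  qed
qed

text \<open>\<open>ev gv\<close> is constant on cosets of the ideal, so the image of a coset is a
  singleton.\<close>

definition tensor_rep :: "((nat \<times> hgen) list \<Rightarrow> 'k) set \<Rightarrow> 'k torus" where
  "tensor_rep X = the_elem (ev gv ` X)"

text \<open>The kernel of \<open>ev gv\<close> is an ideal containing the relations, hence contains
  the ideal they generate.\<close>

lemma ev_gv_ideal:
  assumes "r \<in> TI" shows "r \<in> fa_carrier (tgens n)" "ev gv r = 0"
proof -
  have "tensor_rels q t n \<subseteq> a_kernel FA (torus_ring q) (ev gv)"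
    unfolding a_kernel_def' free_alg_simps torus_ring_simps
    using tensor_rels_subset ev_gv_relations by blast
  moreover have "ideal (a_kernel FA (torus_ring q) (ev gv)) FA"
    by (intro ring_hom_ring.kernel_is_ideal ring_hom_ringI2 ring_free_alg ring_torus_ring ev_hom)
  ultimately have "TI \<subseteq> a_kernel FA (torus_ring q) (ev gv)"
    unfolding tensor_ideal_def by (intro ring.genideal_minimal ring_free_alg)
  then have "r \<in> a_kernel FA (torus_ring q) (ev gv)" using assms by blast
  then show "r \<in> fa_carrier (tgens n)" "ev gv r = 0"
    unfolding a_kernel_def' free_alg_simps torus_ring_simps by simp_all
qed

lemma tensor_rep_proj:
  assumes "f \<in> fa_carrier (tgens n)" shows "tensor_rep (proj f) = ev gv f"
proof -
  have "proj f = (\<lambda>r. fadd r f) ` TI"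
    unfolding proj_def a_r_coset_def' free_alg_simps by blast
  then have "ev gv ` proj f = (\<lambda>r. ev gv (fadd r f)) ` TI" by (simp only: image_image)
  also have "\<dots> = (\<lambda>r. ev gv f) ` TI"
  proof (rule image_cong[OF refl])
    show "ev gv (fadd r f) = ev gv f" if "r \<in> TI" for r
    using ev_gv_ideal[OF that] assms by (simp add: ev_fadd[of _ "tgens n"])
  qed
  also have "\<dots> = {ev gv f}"
    using additive_subgroup.zero_closed[OF ideal.axioms(1)[OF ideal_TI]] by (intro image_constant)
  finally show ?thesis by (simp add: tensor_rep_def)
qed

lemma tensor_rep_hom: "tensor_rep \<in> ring_hom TH (torus_ring q)"
proof (rule ring_hom_memI)
  show "tensor_rep \<one>\<^bsub>TH\<^esub> = \<one>\<^bsub>torus_ring q\<^esub>"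
    by (simp add: tensor_rep_proj flip: proj_simps(4))
qed (auto simp: carrier_TH tensor_rep_proj ev_fmul[of _ "tgens n"] ev_fadd[of _ "tgens n"]
    simp flip: proj_simps(2,3))

sublocale gwa_algebra_torus TH q t n "tensorH_scalar q t n" "\<lambda>i a. proj (fgen (i, a))"
  using tensor_gwa_algebra gwa_torus_axioms quantum_torus_axioms
  by (intro gwa_algebra_torus.intro)

end

section \<open>Embedding of the tensor product and bijectivity of its endomorphisms\<close>

context gwa_torus
begin

lemma tensor_rep_img: "x \<in> carrier TH \<Longrightarrow> tensor_rep x \<in> img"
  by (auto simp: carrier_TH img_def tensor_rep_proj)

lemma tensor_rep_gen: "i < n \<Longrightarrow> tensor_rep (proj (fgen (i, a))) = gv (i, a)"
  by (simp add: tensor_rep_proj tgens_def)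

lemma tensor_rep_scalar: "tensor_rep (tensorH_scalar q t n c) = single 0 c"
  using tensor_rep_proj[of "fconst c"] by (simp add: tensorH_scalar_def proj_def)

lemma tensor_rep_scalar_hom: "scalar_hom tensor_rep"
  by (simp add: scalar_hom_def tensor_rep_hom tensor_rep_scalar)

text \<open>Here both dual families of \<open>hom_inj_on\<close> are the standard unit
  vectors.\<close>

lemma tensor_rep_inj: "inj_on tensor_rep (carrier TH)"
proof (rule hom_inj_on[OF tensor_rep_scalar_hom, of "\<lambda>i. single i 1" "\<lambda>i. single i 1"])
  fix i assume i: "i < n"
  show "\<exists>C. C \<noteq> 0 \<and> tensor_rep (proj (fgen (i, Om))) = single (single i 1, 0) C"
    using i by (simp add: tensor_rep_gen gv_simps)
  show "\<exists>C. C \<noteq> 0 \<and> tensor_rep (proj (fgen (i, Omi))) = single (- single i 1, 0) C"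
    using i by (simp add: tensor_rep_gen gv_simps single_uminus)
  show "tensor_rep (proj (fgen (i, Psi))) \<noteq> 0 \<and>
      (\<forall>u\<in>keys (tensor_rep (proj (fgen (i, Psi)))). snd u = single i 1)"
    using i by (simp add: tensor_rep_gen gv_simps)
  have "gv (i, Psid) \<noteq> 0"
    using mul_max_key(1)[OF av_nz, of "single (0, single i (- 1)) 1" i] by (simp add: gv_def)
  moreover have "snd u = - single i 1" if "u \<in> keys (gv (i, Psid))" for u
    using that by (auto simp: gv_def single_uminus keys_av elim!: keys_mul)
  ultimately show "tensor_rep (proj (fgen (i, Psid))) \<noteq> 0 \<and>
      (\<forall>u\<in>keys (tensor_rep (proj (fgen (i, Psid)))). snd u = - single i 1)"
    using i by (simp add: tensor_rep_gen)
  show "dot (single i 1) (single j 1) = (if i = j then 1 else 0)" for j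
    by (simp add: lookup_single when_def)
qed

text \<open>Injectivity of \<open>f\<close> is inherited from \<Phi>. For surjectivity, the image
  \<open>S\<close> of \<Phi> is shown to contain the torus images of all generators, and
  \<open>tensor_rep_inj\<close> carries this back to the tensor product.\<close>

lemma endomorphism_bij:
  assumes "is_alg_endo q t n f"
  shows "bij_betw f (carrier TH) (carrier TH)"
proof -
  have f_hom: "f \<in> ring_hom TH TH" and f_sc: "f (tensorH_scalar q t n c) = tensorH_scalar q t n c" for c
    using assms by (simp_all add: is_alg_endo_def)
  have f_closed: "f x \<in> carrier TH" if "x \<in> carrier TH" for x
    using ring_hom_closed[OF f_hom that] .
  define \<Phi> where "\<Phi> = tensor_rep \<circ> f"
  have \<Phi>_hom: "scalar_hom \<Phi>"
    unfolding scalar_hom_def \<Phi>_def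
    using ring_hom_trans[OF f_hom tensor_rep_hom] by (simp add: f_sc tensor_rep_scalar)
  note \<Phi>_simps = hom_simps[OF \<Phi>_hom] hom_minus[OF \<Phi>_hom] hom_pow[OF \<Phi>_hom]
  have \<Phi>_img: "\<Phi> x \<in> img" if "x \<in> carrier TH" for x
    using tensor_rep_img f_closed that by (simp add: \<Phi>_def)
  define U where "U i a = \<Phi> (proj (fgen (i, a)))" for i a
  have U_img: "U i a \<in> img" if "i < n" for i a
    using \<Phi>_img that by (simp add: U_def)

  have "\<forall>i. \<exists>\<alpha> c. i < n \<longrightarrow> c \<noteq> 0 \<and> U i Om = single (\<alpha>, 0) c \<and> U i Omi = single (- \<alpha>, 0) (inverse c)"
  proof
    fix i
    show "\<exists>\<alpha> c. i < n \<longrightarrow> c \<noteq> 0 \<and> U i Om = single (\<alpha>, 0) c \<and> U i Omi = single (- \<alpha>, 0) (inverse c)"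
    proof (cases "i < n")
      case True
      have "U i Om \<star> U i Omi = 1"
        using arg_cong[OF Om_Omi[OF True], of \<Phi>] True by (simp add: \<Phi>_simps U_def)
      then show ?thesis using img_unit[OF U_img[OF True] U_img[OF True]] by metis
    qed simp
  qed
  then obtain \<alpha> c where U_Om: "\<And>i. i < n \<Longrightarrow> c i \<noteq> 0" "\<And>i. i < n \<Longrightarrow> U i Om = single (\<alpha> i, 0) (c i)"
    "\<And>i. i < n \<Longrightarrow> U i Omi = single (- \<alpha> i, 0) (inverse (c i))"
    by metis
  \<comment> \<open>The conclusions of \<open>image_of_generators\<close> in one predicate, so that
    the target index and the sign can be chosen as functions of \<open>i\<close>.\<close>
  define gens where "gens i j \<epsilon> \<longleftrightarrow> j < n \<and> \<epsilon> * \<epsilon> = 1 \<and> \<alpha> i = single j \<epsilon> \<and>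
      U i Psi \<noteq> 0 \<and> U i Psid \<noteq> 0 \<and> (\<forall>u\<in>keys (U i Psi). snd u = \<alpha> i) \<and>
      (\<forall>u\<in>keys (U i Psid). snd u = - \<alpha> i) \<and> (\<exists>b b' \<beta> \<beta>'. b \<noteq> 0 \<and> b' \<noteq> 0 \<and>
      (U i Psi = single (\<beta>, single j 1) b \<and> U i Psid = av j \<star> single (\<beta>', - single j 1) b' \<or>
       U i Psid = single (\<beta>, single j 1) b \<and> U i Psi = av j \<star> single (\<beta>', - single j 1) b'))"
    for i j and \<epsilon> :: int
  have "\<exists>j \<epsilon>. gens i j \<epsilon>" if i: "i < n" for i
  proof (rule image_of_generators[OF U_img[OF i, of Psi] U_img[OF i, of Psid], of "\<alpha> i" "c i"])
    show "single (\<alpha> i, 0) (c i) \<in> img" using U_Om(2)[OF i] U_img[OF i, of Om] by simp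
    show "c i \<noteq> 0" by (rule U_Om(1)[OF i])
    show "U i Psi \<star> single (\<alpha> i, 0) (c i) = single 0 q \<star> (single (\<alpha> i, 0) (c i) \<star> U i Psi)"
      using arg_cong[OF Psi_Om[OF i], of \<Phi>] i
      by (simp add: \<Phi>_simps U_Om(2)[OF i, symmetric] U_def)
    show "U i Psid \<star> single (\<alpha> i, 0) (c i) = single 0 (inverse q) \<star> (single (\<alpha> i, 0) (c i) \<star> U i Psid)"
      using arg_cong[OF Psid_Om[OF i], of \<Phi>] i
      by (simp add: \<Phi>_simps U_Om(2)[OF i, symmetric] U_def)
    have pow: "(mul (\<Phi> (proj (fgen (i, Om)))) ^^ t) 1 = single (frag_cmul (int t) (\<alpha> i), 0) (c i ^ t)"
      "(mul (\<Phi> (proj (fgen (i, Omi)))) ^^ t) 1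
        = single (frag_cmul (int t) (- \<alpha> i), 0) (inverse (c i) ^ t)"
      using U_Om(2,3)[OF i] by (simp_all only: U_def pow_single)
    show "U i Psi \<star> U i Psid = single 0 kappa \<star>
        (single 0 (q ^ t) \<star> single (frag_cmul (int t) (\<alpha> i), 0) (c i ^ t)
         - single 0 (inverse q ^ t) \<star> single (frag_cmul (int t) (- \<alpha> i), 0) (inverse (c i) ^ t))"
      using arg_cong[OF Psi_Psid[OF i], of \<Phi>] i by (simp add: \<Phi>_simps U_def pow)
    show "U i Psid \<star> U i Psi = single 0 kappa \<star> (single (frag_cmul (int t) (\<alpha> i), 0) (c i ^ t)
         - single (frag_cmul (int t) (- \<alpha> i), 0) (inverse (c i) ^ t))"
      using arg_cong[OF Psid_Psi[OF i], of \<Phi>] i by (simp add: \<Phi>_simps U_def pow)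
  next
    fix j \<epsilon>
    assume "j < n" "\<epsilon> * \<epsilon> = 1" "\<alpha> i = single j \<epsilon>" "U i Psi \<noteq> 0" "U i Psid \<noteq> 0"
      "\<And>u. u \<in> keys (U i Psi) \<Longrightarrow> snd u = single j \<epsilon>"
      "\<And>u. u \<in> keys (U i Psid) \<Longrightarrow> snd u = - single j \<epsilon>"
      "\<exists>b b' \<beta> \<beta>'. b \<noteq> 0 \<and> b' \<noteq> 0 \<and>
      (U i Psi = single (\<beta>, single j 1) b \<and> U i Psid = av j \<star> single (\<beta>', - single j 1) b' \<or>
       U i Psid = single (\<beta>, single j 1) b \<and> U i Psi = av j \<star> single (\<beta>', - single j 1) b')"
    then have "gens i j \<epsilon>" unfolding gens_def by metis
    then show ?thesis by blast
  qed
  then obtain J E where JE: "\<And>i. i < n \<Longrightarrow> gens i (J i) (E i)" by metis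

  have dual: "dot (\<alpha> i) (\<alpha> j) = (if i = j then 1 else 0)" if ij: "i < n" "j < n" for i j
  proof -
    \<comment> \<open>The exponent of q when \<open>Psi\<close> of factor \<open>i\<close> passes
      \<open>Om\<close> of factor \<open>j\<close>: one within a factor, zero between different
      factors.\<close>
    define m :: int where "m = (if i = j then 1 else 0)"
    have "U i Psi \<star> U j Om = single 0 (q powi m) \<star> (U j Om \<star> U i Psi)"
    proof (cases "i = j")
      case True
      then show ?thesis
        using arg_cong[OF Psi_Om[OF ij(1)], of \<Phi>] ij by (simp add: \<Phi>_simps U_def m_def)
    next
      case False
      then show ?thesis
        using arg_cong[OF g_commute[OF ij False, of Psi Om], of \<Phi>] ij
        by (simp add: \<Phi>_simps U_def m_def)
    qed
    moreover obtain v where v: "v \<in> keys (U i Psi)" "snd v = \<alpha> i"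
      using JE[OF ij(1)] unfolding gens_def by (metis all_not_in_conv keys_eq_empty)
    ultimately show ?thesis
      using q_commuteD[of "U i Psi" "(\<alpha> j, 0)" "c j" m v] U_Om(1,2)[OF ij(2)] by (simp add: m_def)
  qed

  have "inj_on \<Phi> (carrier TH)"
  proof (rule hom_inj_on[OF \<Phi>_hom, of \<alpha> \<alpha>])
    fix i assume i: "i < n"
    show "\<exists>C. C \<noteq> 0 \<and> \<Phi> (proj (fgen (i, Om))) = single (\<alpha> i, 0) C"
      using U_Om(1,2)[OF i] by (auto simp: U_def)
    show "\<exists>C. C \<noteq> 0 \<and> \<Phi> (proj (fgen (i, Omi))) = single (- \<alpha> i, 0) C"
      using U_Om(1,3)[OF i] by (auto simp: U_def intro: exI[of _ "inverse (c i)"])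
    show "\<Phi> (proj (fgen (i, Psi))) \<noteq> 0 \<and> (\<forall>u\<in>keys (\<Phi> (proj (fgen (i, Psi)))). snd u = \<alpha> i)"
      "\<Phi> (proj (fgen (i, Psid))) \<noteq> 0 \<and> (\<forall>u\<in>keys (\<Phi> (proj (fgen (i, Psid)))). snd u = - \<alpha> i)"
      using JE[OF i] unfolding gens_def U_def by blast+
  qed (rule dual)
  then have f_inj: "inj_on f (carrier TH)"
    unfolding \<Phi>_def by (rule inj_on_imageI2)

  \<comment> \<open>If two factors went to the same axis, their vectors \<alpha> would have nonzero
    pairing, against \<open>dual\<close>. So \<open>J\<close> is a permutation of the
    factors.\<close>
  have "inj_on J {..<n}"
  proof (rule inj_onI)
    fix i i' assume i: "i \<in> {..<n}" "i' \<in> {..<n}" "J i = J i'"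
    have "\<alpha> i = single (J i) (E i)" "\<alpha> i' = single (J i) (E i')" "E i * E i = 1" "E i' * E i' = 1"
      using JE[of i] JE[of i'] i by (auto simp: gens_def)
    then have "dot (\<alpha> i) (\<alpha> i') \<noteq> 0" by auto
    then show "i = i'" using dual[of i i'] i by (auto split: if_splits)
  qed
  moreover have "J ` {..<n} \<subseteq> {..<n}" using JE by (auto simp: gens_def)
  ultimately have J_surj: "J ` {..<n} = {..<n}" by (intro endo_inj_surj) auto

  define S where "S = \<Phi> ` carrier TH"
  have S_mul: "P \<star> Q \<in> S" if "P \<in> S" "Q \<in> S" for P Q
    using that by (auto simp: S_def \<Phi>_simps(1)[symmetric])
  have S_add: "P + Q \<in> S" if "P \<in> S" "Q \<in> S" for P Q
    using that by (auto simp: S_def \<Phi>_simps(2)[symmetric])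
  have S_scalar: "single 0 b \<in> S" for b
    unfolding S_def \<Phi>_simps(4)[symmetric] by simp
  have S_U: "U i a \<in> S" if "i < n" for i a
    using that by (simp add: S_def U_def)
  have S_rescale: "single u b' \<in> S" if "single u b \<in> S" "b \<noteq> 0" for u b b'
    using S_mul[OF S_scalar[of "b' / b"] that(1)] that(2) by (simp add: mul_single)
  \<comment> \<open>The images of \<open>Om\<close> and \<open>Omi\<close> carry opposite signs, so
    both powers of \<open>\<Omega>\<^sub>j\<close> lie in \<open>S\<close> up to scalars, whatever
    the sign \<open>E i\<close> is.\<close>
  have S_unit: "single (single j \<epsilon>, 0) 1 \<in> S" if "j < n" "\<epsilon> * \<epsilon> = 1" for j and \<epsilon> :: int
  proof -
    obtain i where i: "i < n" "j = J i" using J_surj \<open>j < n\<close> by (metis imageE lessThan_iff)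
    have E: "\<alpha> i = single j (E i)" "E i * E i = 1" using JE[OF i(1)] i(2) by (auto simp: gens_def)
    have "\<epsilon> = E i \<or> \<epsilon> = - E i" using E(2) that(2) by (metis square_eq_iff)
    then have "single (single j \<epsilon>, 0) (c i) \<in> S \<or> single (single j \<epsilon>, 0) (inverse (c i)) \<in> S"
      using S_U[OF i(1), of Om] S_U[OF i(1), of Omi] U_Om(2,3)[OF i(1)] E(1)
      by (auto simp: single_uminus)
    then show ?thesis using S_rescale U_Om(1)[OF i(1)] by (metis nonzero_imp_inverse_nonzero)
  qed
  have S_zero: "single (0, 0) 1 \<in> S" using S_scalar[of 1] by (simp add: zero_prod_def)
  have S_plus: "single (\<beta> + \<gamma>, 0) 1 \<in> S" if "single (\<beta>, 0) 1 \<in> S" "single (\<gamma>, 0) 1 \<in> S" for \<beta> \<gamma>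
    using S_mul[OF that] by (simp add: mul_single)
  have S_power: "single (single j z, 0) 1 \<in> S" if "j < n" for j z
  proof (induction z rule: int_induct[where k = 0])
    case base
    show ?case using S_zero by simp
  next
    case (step1 z)
    then show ?case using S_plus S_unit[OF that, of 1] by (simp add: single_add)
  next
    case (step2 z)
    then show ?case using S_plus[OF step2(2) S_unit[OF that, of "- 1"]] by (simp flip: single_add)
  qed
  have S_monomial: "single (\<beta>, 0) 1 \<in> S" if "\<And>i. i \<ge> n \<Longrightarrow> lookup \<beta> i = 0" for \<beta>
  proof -
    have "single (\<Sum>i\<in>I. single i (lookup \<beta> i), 0) 1 \<in> S" if "finite I" "I \<subseteq> {..<n}" for I
      using that by (induction I rule: finite_induct) (auto intro: S_zero S_plus S_power)
    moreover have "keys \<beta> \<subseteq> {..<n}"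
    proof
      fix i assume "i \<in> keys \<beta>"
      then show "i \<in> {..<n}" using that[of i] by (auto simp: in_keys_iff not_less[symmetric])
    qed
    moreover have "\<beta> = (\<Sum>i\<in>keys \<beta>. single i (lookup \<beta> i))" by (rule poly_mapping_sum_singles)
    ultimately show ?thesis by (metis finite_keys)
  qed
  \<comment> \<open>Up to a swap, the two images are \<open>gv (j, Psi)\<close> and
    \<open>gv (j, Psid)\<close> times monomial units. These units have indices below
    \<open>n\<close>, so their inverses lie in \<open>S\<close> and can be used to strip them
    off.\<close>
  have S_Psi: "gv (j, Psi) \<in> S \<and> gv (j, Psid) \<in> S" if "j < n" for j
  proof -
    obtain i where i: "i < n" "j = J i" using J_surj \<open>j < n\<close> by (metis imageE lessThan_iff)
    obtain b b' \<beta> \<beta>' where b: "b \<noteq> 0" "b' \<noteq> 0" and cases: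
      "U i Psi = single (\<beta>, single j 1) b \<and> U i Psid = av j \<star> single (\<beta>', - single j 1) b' \<or>
       U i Psid = single (\<beta>, single j 1) b \<and> U i Psi = av j \<star> single (\<beta>', - single j 1) b'"
      using JE[OF i(1)] i(2) unfolding gens_def by blast
    define P Q :: "'k torus" where "P = single (\<beta>, single j 1) b" and "Q = av j \<star> single (\<beta>', - single j 1) b'"
    have PQ: "P \<in> S" "Q \<in> S" "P \<in> img" "Q \<in> img"
      using cases S_U[OF i(1)] U_img[OF i(1)] unfolding P_def Q_def by metis+
    have "lookup \<beta> k = 0" if "k \<ge> n" for k
      using img_support[OF PQ(3) _ that, of "(\<beta>, single j 1)"] b by (simp add: P_def)
    then have "single (- \<beta>, 0) 1 \<in> S" by (intro S_monomial) simp
    then have "single (- \<beta>, 0) 1 \<star> P \<in> S" using S_mul PQ by blast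
    then have "single (0, single j 1) b \<in> S" by (simp add: P_def mul_single)
    then have Psi: "gv (j, Psi) \<in> S" using S_rescale b by (simp add: gv_simps)
    have "lookup \<beta>' k = 0" if "k \<ge> n" for k
    proof -
      \<comment> \<open>One exponent of \<open>Q\<close> is enough: \<open>av j\<close> only shifts
        coordinate \<open>j\<close>, and \<open>j < n\<close>, so at indices from \<open>n\<close>
        on it shows the entries of \<open>\<beta>'\<close>.\<close>
      have "(single j (int t) + \<beta>', - single j 1) \<in> keys Q"
        using single_neq_uminus[of j] b kappa_nz
        by (simp add: Q_def av_def mul_diff_left mul_single in_keys_iff lookup_minus lookup_single_not_eq)
      then have "lookup (single j (int t) + \<beta>') k = 0"
        using img_support[OF PQ(4) _ that] by fastforce
      then show ?thesis using \<open>j < n\<close> that by (simp add: lookup_add lookup_single)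
    qed
    then have "single (- \<beta>', 0) 1 \<in> S" by (intro S_monomial) simp
    then have "Q \<star> single (- \<beta>', 0) 1 \<in> S" using S_mul PQ by blast
    then have "av j \<star> single (0, - single j 1) (b' * q powi dot (- single j 1) (- \<beta>')) \<in> S"
      by (simp add: Q_def mul_single mul_assoc)
    moreover have "b' * q powi dot (- single j 1) (- \<beta>') \<noteq> 0" using b q_nz by simp
    \<comment> \<open>Multiplying on the right reaches the unit behind \<open>av j\<close>; the
      resulting power of q and the coefficient \<open>b'\<close> are collected in
      \<open>e\<close>.\<close>
    ultimately obtain e where e: "e \<noteq> 0" "av j \<star> single (0, - single j 1) e \<in> S" by blast
    have "single 0 (inverse e) \<star> (av j \<star> single (0, - single j 1) e)
        = av j \<star> (single 0 (inverse e) \<star> single (0, - single j 1) e)"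
      by (simp add: scalar_central[of "inverse e" "av j"] flip: mul_assoc)
    also have "\<dots> = av j \<star> single (0, - single j 1) 1" using e(1) by (simp add: mul_single)
    finally have "av j \<star> single (0, - single j 1) 1 \<in> S"
      using S_mul[OF S_scalar[of "inverse e"] e(2)] by simp
    then show ?thesis using Psi by (simp add: gv_def single_uminus)
  qed
  have S_gen: "gv (i, a) \<in> S" if "i < n" for i a
  proof (cases a)
    case Om
    then show ?thesis using S_unit[OF that, of 1] by (simp add: gv_simps)
  next
    case Omi
    then show ?thesis using S_unit[OF that, of "- 1"] by (simp add: gv_simps)
  qed (use S_Psi[OF that] in auto)
  have rep_S: "tensor_rep y \<in> S" if "y \<in> carrier TH" for y
    using that
  proof (rule gen_induct)
    show "tensor_rep (tensorH_scalar q t n c) \<in> S" for c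
      by (simp add: tensor_rep_scalar S_scalar)
    show "tensor_rep (proj (fgen (i, a)) \<otimes>\<^bsub>TH\<^esub> x) \<in> S"
      if "x \<in> carrier TH" "tensor_rep x \<in> S" "i < n" for x i a
      using that S_mul S_gen by (simp add: hom_simps[OF tensor_rep_scalar_hom] tensor_rep_gen)
    show "tensor_rep (x \<oplus>\<^bsub>TH\<^esub> y) \<in> S"
      if "x \<in> carrier TH" "tensor_rep x \<in> S" "y \<in> carrier TH" "tensor_rep y \<in> S" for x y
      using that S_add by (simp add: hom_simps[OF tensor_rep_scalar_hom])
  qed
  have "y \<in> f ` carrier TH" if y: "y \<in> carrier TH" for y
  proof -
    obtain x where x: "x \<in> carrier TH" "tensor_rep y = tensor_rep (f x)"
      using rep_S[OF y] by (auto simp: S_def \<Phi>_def)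
    then have "y = f x" using tensor_rep_inj y f_closed by (auto dest: inj_onD)
    then show ?thesis using x(1) by blast
  qed
  then show ?thesis using f_inj f_closed by (auto simp: bij_betw_def)
qed

end

theorem theorem1p4:
  fixes q :: "'k::field" and t n :: nat
    and f :: "((nat \<times> hgen) list \<Rightarrow> 'k) set \<Rightarrow> ((nat \<times> hgen) list \<Rightarrow> 'k) set"
  assumes "q \<noteq> 0"
    and "\<forall>m::nat. m > 0 \<longrightarrow> q ^ m \<noteq> 1"
    and "t \<ge> 1" and "n \<ge> 1"
    and "is_alg_endo q t n f"
  shows "bij_betw f (carrier (tensorH q t n)) (carrier (tensorH q t n))"
proof -
  interpret gwa_torus q t n
    using assms by unfold_locales auto
  show ?thesis by (rule endomorphism_bij) fact
qed

end
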